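(* Let $n\ge2$ and let $T^{\mathbb{C}}$ be the group of diagonal matrices in $\mathrm{SL}(n,\mathbb{C})=\mathrm{SU}(n)^{\mathbb{C}}$. As a Poisson algebra, the complexification $\mathbb{R}[T^{\mathbb{C}}/S_n]_{\mathbb{C}}$ of the real coordinate ring of the adjoint quotient $T^{\mathbb{C}}/S_n$ for $\mathrm{SU}(n)$ is generated by the power sum functions $\tau_1,\dots,\tau_n,\overline\tau_1,\dots,\overline\tau_n$, and hence by the elementary symmetric functions $\sigma_1,\dots,\sigma_{n-1},\overline\sigma_1,\dots,\overline\sigma_{n-1}$. (Generated as a Poisson algebra means generated as an algebra by the given functions together with iterated Poisson brackets in them.)
   Context: $T^{\mathbb{C}}=\{\mathrm{diag}(z_1,\dots,z_n): z_1\cdots z_n=1\}$, with $S_n$ permuting the entries. The complexified real coordinate ring of the quotient is $$\mathbb{R}[T^{\mathbb{C}}/S_n]_{\mathbb{C}}=\bigl(\mathbb{C}[z_1,\dots,z_n,\overline z_1,\dots,\overline z_n]/(\sigma_n-1,\overline\sigma_n-1)\bigr)^{S_n},$$ where $S_n$ acts diagonally on the $z_j$ and $\overline z_j$, and $\sigma_k$, $\overline\sigma_k$ are the $k$-th elementary symmetric functions in the $z_j$, resp. the $\overline z_j$. Also $\tau_k=\sum_j z_j^k$, $\overline\tau_k=\sum_j\overline z_j^{\,k}$. The Poisson bracket on this ring is the one coming from the symplectic form on $T^{\mathbb{C}}$ obtained by restricting to $T^{\mathbb{C}}\subset(\mathbb{C}^* )^n$ the form $i\partial\overline\partial\sum_j\log^2|z_j|$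 on $(\mathbb{C}^* )^n$, whose Poisson bracket on $(\mathbb{C}^* )^n$ is normalized by $\frac{i}{2}\{\{z_j,\overline z_k\}\}=\delta_{jk}z_j\overline z_j$, $\{\{z_j,z_k\}\}=0=\{\{\overline z_j,\overline z_k\}\}$. *)

theory Defs
  imports
    "HOL-Analysis.Analysis"
    "HOL-Library.Poly_Mapping"
    "HOL-Algebra.QuotRing"
    "HOL-Algebra.Algebraic_Closure_Type"
begin

no_notation fps_nth (infixl \<open>$\<close> 75)

section \<open>Poisson algebras and generation\<close>

record ('a, 'b) poisson_algebra = "('a, 'b) module" +
  pbracket :: "'b \<Rightarrow> 'b \<Rightarrow> 'b"

text \<open>The smallest unital subalgebra that contains \<open>G\<close> and is closed under the bracket.
  Every element of the scalar type counts as a scalar.\<close>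

inductive_set poisson_span ::
    "('a, 'b) poisson_algebra \<Rightarrow> 'b set \<Rightarrow> 'b set"
  for P :: "('a, 'b) poisson_algebra" and G :: "'b set" where
  incl: "a \<in> G \<Longrightarrow> a \<in> poisson_span P G"
| one: "\<one>\<^bsub>P\<^esub> \<in> poisson_span P G"
| add: "\<lbrakk>a \<in> poisson_span P G; b \<in> poisson_span P G\<rbrakk> \<Longrightarrow> a \<oplus>\<^bsub>P\<^esub> b \<in> poisson_span P G"
| mult: "\<lbrakk>a \<in> poisson_span P G; b \<in> poisson_span P G\<rbrakk> \<Longrightarrow> a \<otimes>\<^bsub>P\<^esub> b \<in> poisson_span P G"
| smult: "a \<in> poisson_span P G \<Longrightarrow> c \<odot>\<^bsub>P\<^esub> a \<in> poisson_span P G"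
| bracket: "\<lbrakk>a \<in> poisson_span P G; b \<in> poisson_span P G\<rbrakk> \<Longrightarrow> pbracket P a b \<in> poisson_span P G"

definition poisson_generates :: "('a, 'b) poisson_algebra \<Rightarrow> 'b set \<Rightarrow> bool" where
  "poisson_generates P G \<longleftrightarrow> G \<subseteq> carrier P \<and> poisson_span P G = carrier P"


section \<open>Polynomials in \<open>z\<^sub>j\<close> and their conjugates\<close>

text \<open>The index type \<open>'n\<close> plays the role of \<open>{1,\<dots>,n}\<close>.  The variable \<open>Inl j\<close> is
  \<open>z\<^sub>j\<close>, and \<open>Inr j\<close> is the formally independent variable for the conjugate of \<open>z\<^sub>j\<close>.\<close>

type_synonym 'n zpoly = "(('n + 'n) \<Rightarrow>\<^sub>0 nat) \<Rightarrow>\<^sub>0 complex"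

definition Const :: "complex \<Rightarrow> 'n zpoly" where
  "Const c = Poly_Mapping.single 0 c"

definition Var :: "'n + 'n \<Rightarrow> 'n zpoly" where
  "Var v = Poly_Mapping.single (Poly_Mapping.single v 1) 1"

text \<open>Substitution of \<open>x v\<close> for the variable \<open>v\<close>, with \<open>h\<close> applied to the coefficients.\<close>

definition psubst :: "(complex \<Rightarrow> 'b::comm_ring_1) \<Rightarrow> ('n::finite + 'n \<Rightarrow> 'b) \<Rightarrow> 'n zpoly \<Rightarrow> 'b"
  where "psubst h x p =
    (\<Sum>m\<in>Poly_Mapping.keys p. h (Poly_Mapping.lookup p m) *
      (\<Prod>v\<in>UNIV. x v ^ Poly_Mapping.lookup m v))"

definition peval :: "'n::finite zpoly \<Rightarrow> complex ^ 'n \<Rightarrow> complex" where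
  "peval p z = psubst (\<lambda>c. c) (case_sum (\<lambda>j. z $ j) (\<lambda>j. cnj (z $ j))) p"

text \<open>The diagonal action: \<open>\<pi>\<close> permutes the \<open>z\<^sub>j\<close> and their conjugates simultaneously.\<close>

definition perm_act :: "('n::finite \<Rightarrow> 'n) \<Rightarrow> 'n zpoly \<Rightarrow> 'n zpoly" where
  "perm_act \<pi> p = psubst Const (\<lambda>v. Var (map_sum \<pi> \<pi> v)) p"

definition elem_sym :: "nat \<Rightarrow> 'n::finite zpoly" where
  "elem_sym k = (\<Sum>S | card S = k. \<Prod>j\<in>S. Var (Inl j))"

definition elem_sym_bar :: "nat \<Rightarrow> 'n::finite zpoly" where
  "elem_sym_bar k = (\<Sum>S | card S = k. \<Prod>j\<in>S. Var (Inr j))"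

definition power_sum :: "nat \<Rightarrow> 'n::finite zpoly" where
  "power_sum k = (\<Sum>j\<in>UNIV. Var (Inl j) ^ k)"

definition power_sum_bar :: "nat \<Rightarrow> 'n::finite zpoly" where
  "power_sum_bar k = (\<Sum>j\<in>UNIV. Var (Inr j) ^ k)"


section \<open>The symplectic form and its Poisson bracket\<close>

definition wirtinger :: "'n::finite \<Rightarrow> (complex ^ 'n \<Rightarrow> complex) \<Rightarrow> complex ^ 'n \<Rightarrow> complex" where
  "wirtinger j f z =
    (frechet_derivative f (at z) (axis j 1) - \<i> * frechet_derivative f (at z) (axis j \<i>)) / 2"

definition wirtinger_bar :: "'n::finite \<Rightarrow> (complex ^ 'n \<Rightarrow> complex) \<Rightarrow> complex ^ 'n \<Rightarrow> complex"
  where "wirtinger_bar j f z =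
    (frechet_derivative f (at z) (axis j 1) + \<i> * frechet_derivative f (at z) (axis j \<i>)) / 2"

text \<open>The 2-form \<open>i \<partial>\<partial>\<^sup>-\<phi>\<close>, i.e. the sum over \<open>j, k\<close> of
  \<open>i \<partial>\<^sup>2\<phi>/\<partial>z\<^sub>j\<partial>z\<^sub>k\<^sup>- dz\<^sub>j \<and> dz\<^sub>k\<^sup>-\<close> (a bar is written as a superscript minus),
  with \<open>(\<alpha> \<and> \<beta>)(v, w) = \<alpha>(v)\<beta>(w) - \<alpha>(w)\<beta>(v)\<close>.  For real \<open>\<phi>\<close> of class \<open>C\<^sup>2\<close> this is a
  real number, so that \<open>Re\<close> only adjusts the type.\<close>

definition i_ddbar ::
    "(complex ^ 'n::finite \<Rightarrow> real) \<Rightarrow> complex ^ 'n \<Rightarrow> complex ^ 'n \<Rightarrow> complex ^ 'n \<Rightarrow> real" where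
  "i_ddbar \<phi> z v w =
    Re (\<i> * (\<Sum>j\<in>UNIV. \<Sum>k\<in>UNIV. wirtinger j (wirtinger_bar k (\<lambda>u. complex_of_real (\<phi> u))) z *
      (v $ j * cnj (w $ k) - w $ j * cnj (v $ k))))"

definition sympl :: "complex ^ 'n::finite \<Rightarrow> complex ^ 'n \<Rightarrow> complex ^ 'n \<Rightarrow> real" where
  "sympl = i_ddbar (\<lambda>z. \<Sum>j\<in>UNIV. (ln (cmod (z $ j)))\<^sup>2)"

text \<open>Here \<open>V\<close> is the tangent space at \<open>z\<close> of a submanifold of \<open>(\<complex>\<^sup>*)\<^sup>n\<close> on which \<open>sympl\<close>
  restricts to a symplectic form.  Only the differential of \<open>f\<close> along \<open>V\<close> matters.\<close>

definition ham_vector ::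
    "(complex ^ 'n::finite) set \<Rightarrow> (complex ^ 'n \<Rightarrow> real) \<Rightarrow> complex ^ 'n \<Rightarrow> complex ^ 'n" where
  "ham_vector V f z =
    (THE x. x \<in> V \<and> (\<forall>v\<in>V. sympl z x v = frechet_derivative f (at z) v))"

definition real_bracket ::
    "(complex ^ 'n::finite) set \<Rightarrow> (complex ^ 'n \<Rightarrow> real) \<Rightarrow> (complex ^ 'n \<Rightarrow> real) \<Rightarrow>
      complex ^ 'n \<Rightarrow> real" where
  "real_bracket V f g z = sympl z (ham_vector V f z) (ham_vector V g z)"

text \<open>The complex bilinear extension to complex-valued functions.  For \<open>V = UNIV\<close> and \<open>z\<close> with
  nonzero coordinates this is the bracket on \<open>(\<complex>\<^sup>*)\<^sup>n\<close>, with
  \<open>(i/2) * fun_bracket UNIV (\<lambda>u. u $ j) (\<lambda>u. cnj (u $ k)) z = (if j = k then z $ j * cnj (z $ j) else 0)\<close>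
  and zero brackets among the \<open>z\<^sub>j\<close> and among their conjugates.\<close>

definition fun_bracket ::
    "(complex ^ 'n::finite) set \<Rightarrow> (complex ^ 'n \<Rightarrow> complex) \<Rightarrow> (complex ^ 'n \<Rightarrow> complex) \<Rightarrow>
      complex ^ 'n \<Rightarrow> complex" where
  "fun_bracket V f g z = Complex
    (real_bracket V (\<lambda>u. Re (f u)) (\<lambda>u. Re (g u)) z - real_bracket V (\<lambda>u. Im (f u)) (\<lambda>u. Im (g u)) z)
    (real_bracket V (\<lambda>u. Re (f u)) (\<lambda>u. Im (g u)) z + real_bracket V (\<lambda>u. Im (f u)) (\<lambda>u. Re (g u)) z)"

text \<open>The diagonal torus in \<open>SL(n,\<complex>)\<close>, a diagonal matrix being given by its diagonal.\<close>

definition torus :: "(complex ^ 'n::finite) set" where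
  "torus = {z. (\<Prod>j\<in>UNIV. z $ j) = 1}"

definition torus_tangent :: "complex ^ 'n::finite \<Rightarrow> (complex ^ 'n) set" where
  "torus_tangent z = {v. frechet_derivative (\<lambda>u. \<Prod>j\<in>UNIV. u $ j) (at z) v = 0}"


section \<open>The complexified real coordinate ring of the adjoint quotient\<close>

definition torus_ideal :: "'n::finite zpoly set" where
  "torus_ideal = genideal ring_of_type_algebra
    {elem_sym CARD('n) - 1, elem_sym_bar CARD('n) - 1}"

definition torus_ring :: "'n::finite zpoly set ring" where
  "torus_ring = ring_of_type_algebra Quot torus_ideal"

definition cls :: "'n::finite zpoly \<Rightarrow> 'n zpoly set" where
  "cls p = torus_ideal +>\<^bsub>ring_of_type_algebra\<^esub> p"

text \<open>The class whose restriction to the torus is the Poisson bracket of the restrictions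
  of \<open>a\<close> and \<open>b\<close>.\<close>

definition torus_bracket :: "'n::finite zpoly set \<Rightarrow> 'n zpoly set \<Rightarrow> 'n zpoly set" where
  "torus_bracket a b = (THE c. c \<in> carrier torus_ring \<and>
    (\<forall>p\<in>a. \<forall>q\<in>b. \<forall>r\<in>c. \<forall>z\<in>torus.
      peval r z = fun_bracket (torus_tangent z) (peval p) (peval q) z))"

definition adjoint_quotient :: "(complex, 'n::finite zpoly set) poisson_algebra" where
  "adjoint_quotient =
    \<lparr>carrier = {a \<in> carrier torus_ring. \<forall>\<pi>. bij \<pi> \<longrightarrow> perm_act \<pi> ` a = a},
     mult = mult torus_ring, one = one torus_ring, zero = zero torus_ring, add = add torus_ring,
     smult = (\<lambda>c a. cls (Const c) \<otimes>\<^bsub>torus_ring\<^esub> a),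
     pbracket = torus_bracket\<rparr>"

end

theory Submission
  imports Defs
begin

text \<open>The mechanism is that the bracket produces the mixed power sums.  In logarithmic coordinates
  \<open>z\<^sub>j = exp w\<^sub>j\<close> the symplectic form is constant, and the tangent space of the torus is the complex
  hyperplane \<open>\<Sum>\<^sub>j dw\<^sub>j = 0\<close>.  Hence the bracket of polynomials \<open>p\<close>, \<open>q\<close> on the torus is that of a
  flat space, projected to this hyperplane.  Write \<open>E\<^sub>j\<close> for \<open>z\<^sub>j \<partial>/\<partial>z\<^sub>j\<close> and \<open>E'\<^sub>j\<close> for the same
  operator in the conjugate variable.  Then the bracket is \<open>- 2 \<i> (h p q - h q p)\<close> with
  \<open>h p q = \<Sum>\<^sub>j (E\<^sub>j p) (E'\<^sub>j q) - (\<Sum>\<^sub>j E\<^sub>j p) (\<Sum>\<^sub>k E'\<^sub>k q) / n\<close> (\<open>fun_bracket_peval\<close>).  Applied to a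
  power sum in the \<open>z\<^sub>j\<close> of exponent \<open>k\<close> and one in the conjugates of exponent \<open>l\<close>, with \<open>k, l \<ge> 1\<close>,
  it gives, up to a nonzero factor and a multiple of their product, the sum of all
  \<open>z\<^sub>j\<^sup>k z\<^sub>j\<^sup>-\<^sup>l\<close>, where \<open>z\<^sub>j\<^sup>-\<close> is the conjugate (\<open>poly_bracket_power_sums\<close>).

  By a theorem of Weyl these mixed power sums generate all polynomials invariant under the diagonal
  action, as an algebra: the sum of a monomial over its orbit is built up one index at a time from
  sums over injections (\<open>injection_sum_in_subring\<close>).  Newton's identities yield the power sums of
  all exponents, either from the first \<open>n\<close> of them or from the elementary symmetric functions, the
  \<open>n\<close>-th of which is \<open>1\<close> in the quotient.

  The remaining point is that these polynomial computations describe the ring at hand.  The bracket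
  of two classes is specified by the values of its representatives on the torus, so it is
  determined only because a polynomial that vanishes on the torus lies in the ideal
  (\<open>vanishing_on_torus_imp_torus_ideal\<close>).  This follows from the linear independence of characters:
  monomials restrict to characters of the torus, and two of them restrict to the same character
  only if they are congruent modulo the ideal.  Conversely the bracket is well defined on classes
  because \<open>\<sigma>\<^sub>n\<close> and its conjugate are Casimir functions of the polynomial bracket
  (\<open>poly_bracket_torus_ideal_left\<close>).  Averaging over the finite group represents every invariant
  class by an invariant polynomial (\<open>invariant_cls_has_symmetric_representative\<close>).\<close>

section \<open>Newton's identities\<close>

text \<open>With \<open>E = \<Prod>\<^sub>j (1 + x\<^sub>j X)\<close> as a formal power series, the identity compares coefficients in the
  logarithmic derivative \<open>E' = E \<cdot> \<Sum>\<^sub>j x\<^sub>j / (1 + x\<^sub>j X)\<close>.  All orders are treated at once, since the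
  elementary symmetric functions of degree above \<open>card A\<close> are empty sums.\<close>

lemma newton_identity:
  fixes x :: "'a \<Rightarrow> 'b::comm_ring_1"
  assumes "finite A"
  shows "of_nat (Suc m) * (\<Sum>S | S \<subseteq> A \<and> card S = Suc m. \<Prod>j\<in>S. x j) =
    (\<Sum>k\<le>m. (-1) ^ k * (\<Sum>j\<in>A. x j ^ Suc k) * (\<Sum>S | S \<subseteq> A \<and> card S = m - k. \<Prod>j\<in>S. x j))"
proof -
  define E where "E A = (\<Prod>j\<in>A. fps_const (x j) * fps_X + 1)" for A
  define Q where "Q j = Abs_fps (\<lambda>k. (-1) ^ k * x j ^ Suc k)" for j
  have geom: "(fps_const (x j) * fps_X + 1) * Q j = fps_const (x j)" for j
  proof (rule fps_ext)
    fix k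
    have "fps_nth ((fps_const (x j) * fps_X + 1) * Q j) k =
        x j * fps_nth (fps_X * Q j) k + fps_nth (Q j) k"
      by (simp add: distrib_right mult.assoc)
    then show "fps_nth ((fps_const (x j) * fps_X + 1) * Q j) k = fps_nth (fps_const (x j)) k"
      by (cases k) (simp_all add: Q_def)
  qed
  have deriv: "fps_deriv (E A) = E A * (\<Sum>j\<in>A. Q j)"
    using assms
  proof (induction A)
    case empty
    show ?case by (simp add: E_def)
  next
    case (insert a A)
    have E: "E (insert a A) = (fps_const (x a) * fps_X + 1) * E A"
      using insert.hyps by (simp add: E_def)
    have "fps_deriv (E (insert a A)) =
        fps_const (x a) * E A + (fps_const (x a) * fps_X + 1) * (E A * (\<Sum>j\<in>A. Q j))"
      unfolding E using insert.IH by (simp add: algebra_simps)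
    also have "fps_const (x a) * E A = (fps_const (x a) * fps_X + 1) * Q a * E A"
      by (simp only: geom)
    also have "\<dots> + (fps_const (x a) * fps_X + 1) * (E A * (\<Sum>j\<in>A. Q j)) =
        E (insert a A) * (\<Sum>j\<in>insert a A. Q j)"
      unfolding E using insert.hyps by (simp add: algebra_simps)
    finally show ?case .
  qed
  have coeff: "fps_nth (E A) k = (\<Sum>S | S \<subseteq> A \<and> card S = k. \<Prod>j\<in>S. x j)" for k
  proof -
    have prod_const: "(\<Prod>j\<in>S. fps_const (x j)) = fps_const (\<Prod>j\<in>S. x j)" for S
      by (induction S rule: infinite_finite_induct) simp_all
    have "E A = (\<Sum>S\<in>Pow A. fps_const (\<Prod>j\<in>S. x j) * fps_X ^ card S)"
      unfolding E_def using assms by (simp add: prod_add prod.distrib prod_const)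
    then have "fps_nth (E A) k = (\<Sum>S\<in>Pow A. if card S = k then \<Prod>j\<in>S. x j else 0)"
      by (auto simp: fps_sum_nth fps_X_power_iff intro!: sum.cong)
    also have "\<dots> = (\<Sum>S | S \<subseteq> A \<and> card S = k. \<Prod>j\<in>S. x j)"
      using assms by (simp add: sum.If_cases Int_def Collect_conj_eq[symmetric] Pow_def)
    finally show ?thesis .
  qed
  have "fps_nth (fps_deriv (E A)) m = fps_nth ((\<Sum>j\<in>A. Q j) * E A) m"
    by (simp add: deriv mult.commute)
  then show ?thesis
    by (simp add: coeff fps_mult_nth fps_sum_nth Q_def sum_distrib_left atMost_atLeast0)
qed

section \<open>Sums over injections\<close>

text \<open>Functions are made extensional so that a sum over this set counts every injection of \<open>A\<close>
  once.\<close>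

definition injections :: "'j set \<Rightarrow> ('j \<Rightarrow> 'i) set" where
  "injections A = {f \<in> A \<rightarrow>\<^sub>E UNIV. inj_on f A}"

lemma sum_injections_insert:
  fixes g :: "('j \<Rightarrow> 'i::finite) \<Rightarrow> 'r::comm_monoid_add"
  assumes "finite A" and "a \<notin> A"
  shows "(\<Sum>f\<in>injections (insert a A). g f) =
    (\<Sum>f\<in>injections A. \<Sum>x\<in>- f ` A. g (f(a := x)))"
proof -
  have fin: "finite (injections A :: ('j \<Rightarrow> 'i) set)"
    using finite_PiE[OF assms(1), of "\<lambda>_. UNIV :: 'i set"] unfolding injections_def by simp
  have "(\<Sum>f\<in>injections A. \<Sum>x\<in>- f ` A. g (f(a := x))) =
      (\<Sum>(f, x)\<in>(SIGMA f:injections A. - f ` A). g (f(a := x)))"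
    using fin by (simp add: sum.Sigma)
  also have "\<dots> = (\<Sum>f\<in>injections (insert a A). g f)"
  proof (rule sum.reindex_bij_witness[where j = "\<lambda>(f, x). f(a := x)"
        and i = "\<lambda>f. (f(a := undefined), f a)"])
    fix q :: "('j \<Rightarrow> 'i) \<times> 'i"
    assume "q \<in> (SIGMA f:injections A. - f ` A)"
    then obtain f x where q: "q = (f, x)" "f \<in> injections A" "x \<notin> f ` A" by auto
    then have "f(a := undefined) = f"
      using assms by (auto simp: injections_def PiE_def extensional_def)
    then show "((case q of (f, x) \<Rightarrow> f(a := x))(a := undefined), (case q of (f, x) \<Rightarrow> f(a := x)) a) = q"
      using q by simp
    show "(case q of (f, x) \<Rightarrow> f(a := x)) \<in> injections (insert a A)"
      using q assms by (auto simp: injections_def PiE_def extensional_def inj_on_def)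
  next
    fix f :: "'j \<Rightarrow> 'i"
    assume f: "f \<in> injections (insert a A)"
    show "(f(a := undefined), f a) \<in> (SIGMA f:injections A. - f ` A)"
      using f assms by (auto simp: injections_def PiE_def extensional_def inj_on_def)
  qed auto
  finally show ?thesis by simp
qed

text \<open>The inductive step of Weyl's theorem.  Extending an injection \<open>f\<close> of \<open>A\<close> to \<open>insert a A\<close> means
  choosing a value outside \<open>f ` A\<close>.  Allowing all values gives a power sum times the sum for \<open>A\<close>;
  the excess consists of the terms in which \<open>a\<close> is sent to some \<open>f b\<close>, and there multiplicativity
  of \<open>u\<close> merges the exponents of \<open>a\<close> and \<open>b\<close>, so that these terms are again sums over injections
  of \<open>A\<close>.\<close>

lemma injection_sum_in_subring:
  fixes u :: "'m::ab_semigroup_add \<Rightarrow> 'i::finite \<Rightarrow> 'r::comm_ring_1"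
  assumes mult: "\<And>d e i. u (d + e) i = u d i * u e i"
    and one: "1 \<in> U"
    and diff: "\<And>p q. p \<in> U \<Longrightarrow> q \<in> U \<Longrightarrow> p - q \<in> U"
    and times: "\<And>p q. p \<in> U \<Longrightarrow> q \<in> U \<Longrightarrow> p * q \<in> U"
    and power_sums: "\<And>e. (\<Sum>i\<in>UNIV. u e i) \<in> U"
    and "finite A"
  shows "(\<Sum>f\<in>injections A. \<Prod>j\<in>A. u (e j) (f j)) \<in> U"
  using \<open>finite A\<close>
proof (induction A arbitrary: e)
  case empty
  have "injections ({} :: 'a set) = ({\<lambda>_. undefined} :: ('a \<Rightarrow> 'i) set)"
    by (simp add: injections_def)
  then show ?case using one by simp
next
  case (insert a A)
  have zero: "0 \<in> U" using diff[OF one one] by simp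
  have neg: "- p \<in> U" if "p \<in> U" for p using diff[OF zero that] by simp
  have add: "p + q \<in> U" if "p \<in> U" "q \<in> U" for p q using diff[OF that(1) neg[OF that(2)]] by simp
  have sum: "sum g B \<in> U" if "\<And>b. b \<in> B \<Longrightarrow> g b \<in> U" for g and B :: "'a set"
    using that by (induction B rule: infinite_finite_induct) (simp_all add: zero add)
  define merged where "merged b = e(b := e b + e a)" for b
  have merge: "u (e a) (f b) * (\<Prod>j\<in>A. u (e j) (f j)) = (\<Prod>j\<in>A. u (merged b j) (f j))"
    if "b \<in> A" for b and f :: "'a \<Rightarrow> 'i"
  proof -
    have "(\<Prod>j\<in>A. u (merged b j) (f j)) = u (merged b b) (f b) * (\<Prod>j\<in>A - {b}. u (merged b j) (f j))"
      using insert.hyps that by (intro prod.remove) auto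
    also have "(\<Prod>j\<in>A - {b}. u (merged b j) (f j)) = (\<Prod>j\<in>A - {b}. u (e j) (f j))"
      by (rule prod.cong) (auto simp: merged_def)
    also have "u (merged b b) (f b) * \<dots> = u (e a) (f b) * (u (e b) (f b) * \<dots>)"
      by (simp add: merged_def mult ac_simps)
    also have "u (e b) (f b) * (\<Prod>j\<in>A - {b}. u (e j) (f j)) = (\<Prod>j\<in>A. u (e j) (f j))"
      using insert.hyps that by (intro prod.remove[symmetric]) auto
    finally show ?thesis by simp
  qed
  have inner: "(\<Sum>x\<in>- f ` A. \<Prod>j\<in>insert a A. u (e j) ((f(a := x)) j)) =
      (\<Sum>i\<in>UNIV. u (e a) i) * (\<Prod>j\<in>A. u (e j) (f j)) - (\<Sum>b\<in>A. \<Prod>j\<in>A. u (merged b j) (f j))"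
    if "f \<in> injections A" for f :: "'a \<Rightarrow> 'i"
  proof -
    have inj: "inj_on f A" using that by (simp add: injections_def)
    have "(\<Prod>j\<in>insert a A. u (e j) ((f(a := x)) j)) = u (e a) x * (\<Prod>j\<in>A. u (e j) (f j))" for x
      using insert.hyps by (auto intro!: prod.cong arg_cong2[where f = "(*)"])
    then have "(\<Sum>x\<in>- f ` A. \<Prod>j\<in>insert a A. u (e j) ((f(a := x)) j)) =
        (\<Sum>x\<in>- f ` A. u (e a) x) * (\<Prod>j\<in>A. u (e j) (f j))"
      by (simp add: sum_distrib_right)
    also have "(\<Sum>x\<in>- f ` A. u (e a) x) = (\<Sum>i\<in>UNIV. u (e a) i) - (\<Sum>x\<in>f ` A. u (e a) x)"
      by (simp add: Compl_eq_Diff_UNIV sum_diff)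
    also have "(\<Sum>x\<in>f ` A. u (e a) x) = (\<Sum>b\<in>A. u (e a) (f b))"
      using inj by (simp add: sum.reindex)
    finally show ?thesis
      by (simp add: left_diff_distrib sum_distrib_right merge)
  qed
  have "(\<Sum>f\<in>injections (insert a A). \<Prod>j\<in>insert a A. u (e j) (f j)) =
      (\<Sum>f\<in>injections A. (\<Sum>i\<in>UNIV. u (e a) i) * (\<Prod>j\<in>A. u (e j) (f j)) -
        (\<Sum>b\<in>A. \<Prod>j\<in>A. u (merged b j) (f j)))"
    unfolding sum_injections_insert[OF insert.hyps] by (intro sum.cong refl inner)
  also have "\<dots> = (\<Sum>i\<in>UNIV. u (e a) i) * (\<Sum>f\<in>injections A. \<Prod>j\<in>A. u (e j) (f j)) -
      (\<Sum>b\<in>A. \<Sum>f\<in>injections A. \<Prod>j\<in>A. u (merged b j) (f j))"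
    unfolding sum_subtractf sum_distrib_left by (subst sum.swap) (rule refl)
  also have "\<dots> \<in> U"
    by (intro diff times power_sums insert.IH sum)
  finally show ?case .
qed

section \<open>Polynomials, substitutions and Euler operators\<close>

lemma single_eq_Const_prod_Var:
  "Poly_Mapping.single m c = Const c * (\<Prod>v\<in>UNIV. Var v ^ Poly_Mapping.lookup m v)"
  for m :: "'n::finite + 'n \<Rightarrow>\<^sub>0 nat"
proof -
  have power: "Var v ^ k = Poly_Mapping.single (Poly_Mapping.single v k) 1" for v :: "'n + 'n" and k
    by (induction k) (simp_all add: Var_def mult_single single_add[symmetric])
  have "(\<Prod>v\<in>V. Var v ^ Poly_Mapping.lookup m v) =
      Poly_Mapping.single (\<Sum>v\<in>V. Poly_Mapping.single v (Poly_Mapping.lookup m v)) 1"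
    if "finite V" for V
    using that by (induction V) (simp_all add: power mult_single)
  moreover have "(\<Sum>v\<in>UNIV. Poly_Mapping.single v (Poly_Mapping.lookup m v)) = m"
    by (intro poly_mapping_eqI) (simp add: lookup_sum lookup_single when_def)
  ultimately show ?thesis by (simp add: Const_def mult_single)
qed

lemma sum_monomials: "p = (\<Sum>m\<in>Poly_Mapping.keys p. Poly_Mapping.single m (Poly_Mapping.lookup p m))"
  by (intro poly_mapping_eqI)
    (simp add: lookup_sum lookup_single when_def in_keys_iff[symmetric] not_in_keys_iff_lookup_eq_zero)

lemma zpoly_induct [case_names Const Var add mult]:
  fixes p :: "'n::finite zpoly"
  assumes Const: "\<And>c. P (Const c)" and Var: "\<And>v. P (Var v)"
    and add: "\<And>p q. P p \<Longrightarrow> P q \<Longrightarrow> P (p + q)" and mult: "\<And>p q. P p \<Longrightarrow> P q \<Longrightarrow> P (p * q)"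
  shows "P p"
proof -
  have zero: "P 0" and one: "P 1"
    using Const[of 0] Const[of 1] by (simp_all add: Const_def)
  have power: "P (Var v ^ k)" for v k
    by (induction k) (simp_all add: one mult Var)
  have "P (\<Prod>v\<in>V. Var v ^ Poly_Mapping.lookup m v)" for V m
    by (induction V rule: infinite_finite_induct) (simp_all add: one mult power)
  then have "P (Poly_Mapping.single m c)" for m c
    by (simp add: single_eq_Const_prod_Var mult Const)
  then have "P (\<Sum>m\<in>M. Poly_Mapping.single m (Poly_Mapping.lookup p m))" for M
    by (induction M rule: infinite_finite_induct) (simp_all add: zero add)
  then show ?thesis by (subst sum_monomials)
qed

locale coefficient_hom =
  fixes h :: "complex \<Rightarrow> 'b::comm_ring_1"
  assumes hom_add: "h (a + b) = h a + h b" and hom_mult: "h (a * b) = h a * h b" and hom_one: "h 1 = 1"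
begin

lemma hom_zero: "h 0 = 0"
  using hom_add[of 0 0] by simp

lemma psubst_superset:
  assumes "finite M" "Poly_Mapping.keys p \<subseteq> M"
  shows "psubst h x p = (\<Sum>m\<in>M. h (Poly_Mapping.lookup p m) * (\<Prod>v\<in>UNIV. x v ^ Poly_Mapping.lookup m v))"
  unfolding psubst_def using assms
  by (intro sum.mono_neutral_left) (auto simp: in_keys_iff hom_zero)

lemma psubst_single: "psubst h x (Poly_Mapping.single m c) = h c * (\<Prod>v\<in>UNIV. x v ^ Poly_Mapping.lookup m v)"
  by (subst psubst_superset[of "{m}"]) simp_all

lemma psubst_add: "psubst h x (p + q) = psubst h x p + psubst h x q"
proof -
  let ?M = "Poly_Mapping.keys p \<union> Poly_Mapping.keys q"
  have "Poly_Mapping.keys (p + q) \<subseteq> ?M" by (rule keys_add)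
  then show ?thesis
    by (simp add: psubst_superset[of ?M] lookup_add hom_add distrib_right sum.distrib)
qed

lemma psubst_zero: "psubst h x 0 = 0"
  by (simp add: psubst_def)

lemma psubst_sum: "psubst h x (sum f A) = (\<Sum>a\<in>A. psubst h x (f a))"
  by (induction A rule: infinite_finite_induct) (simp_all add: psubst_add psubst_zero)

lemma psubst_mult: "psubst h x (p * q) = psubst h x p * psubst h x q"
proof -
  have "psubst h x (Poly_Mapping.single m c * Poly_Mapping.single m' c') =
      psubst h x (Poly_Mapping.single m c) * psubst h x (Poly_Mapping.single m' c')" for m m' c c'
    by (simp add: mult_single psubst_single hom_mult lookup_add power_add prod.distrib mult_ac)
  then have "psubst h x ((\<Sum>m\<in>M. Poly_Mapping.single m (f m)) * (\<Sum>m\<in>M'. Poly_Mapping.single m (g m))) =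
      psubst h x (\<Sum>m\<in>M. Poly_Mapping.single m (f m)) * psubst h x (\<Sum>m\<in>M'. Poly_Mapping.single m (g m))"
    for M M' f g
    by (simp add: sum_product psubst_sum)
  from this[of "Poly_Mapping.lookup p" "Poly_Mapping.keys p" "Poly_Mapping.lookup q" "Poly_Mapping.keys q"]
  show ?thesis
    by (simp only: sum_monomials[symmetric])
qed

lemma psubst_Const: "psubst h x (Const c) = h c"
  by (simp add: Const_def psubst_single)

lemma psubst_one: "psubst h x 1 = 1"
  using psubst_Const[of x 1] by (simp add: Const_def hom_one)

lemma psubst_Var: "psubst h x (Var v) = x v"
proof -
  have "(\<Prod>w\<in>UNIV. x w ^ Poly_Mapping.lookup (Poly_Mapping.single v (1::nat)) w) = (\<Prod>w\<in>UNIV. if w = v then x w else 1)"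
    by (intro prod.cong) (auto simp: lookup_single when_def)
  then show ?thesis
    by (simp add: Var_def psubst_single hom_one)
qed

lemma psubst_diff: "psubst h x (p - q) = psubst h x p - psubst h x q"
  using psubst_add[of x "p - q" q] by simp

lemma psubst_prod: "psubst h x (prod f A) = (\<Prod>a\<in>A. psubst h x (f a))"
  by (induction A rule: infinite_finite_induct) (simp_all add: psubst_mult psubst_one)

lemma psubst_power: "psubst h x (p ^ k) = psubst h x p ^ k"
  by (induction k) (simp_all add: psubst_mult psubst_one)

lemmas psubst_simps = psubst_add psubst_zero psubst_sum psubst_mult psubst_Const psubst_one
  psubst_Var psubst_diff psubst_prod psubst_power

end

lemma Const_add: "Const (a + b) = Const a + Const b"
  and Const_mult: "Const (a * b) = Const a * Const b"
  and Const_one: "Const 1 = 1"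
  and Const_of_nat: "Const (of_nat k) = of_nat k"
  by (simp_all add: Const_def single_add mult_single)

interpretation eval: coefficient_hom "\<lambda>c. c"
  by unfold_locales simp_all

interpretation substitute: coefficient_hom Const
  by unfold_locales (simp_all add: Const_add Const_mult Const_one)

lemmas peval_simps = eval.psubst_simps[where x = "case_sum (\<lambda>j. z $ j) (\<lambda>j. cnj (z $ j))" for z,
    folded peval_def]

lemmas perm_act_simps = substitute.psubst_simps[where x = "\<lambda>v. Var (map_sum \<pi> \<pi> v)"
      for \<pi> :: "'n::finite \<Rightarrow> 'n",
    folded perm_act_def]

lemma perm_act_comp: "perm_act \<pi> (perm_act \<rho> p) = perm_act (\<pi> \<circ> \<rho>) p"
proof (induction p rule: zpoly_induct)
  case (Var v)
  show ?case by (cases v) (simp_all add: perm_act_simps)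
qed (simp_all only: perm_act_simps)

lemma perm_act_id: "perm_act id p = p"
proof (induction p rule: zpoly_induct)
  case (Var v)
  show ?case by (cases v) (simp_all add: perm_act_simps)
qed (simp_all only: perm_act_simps)

text \<open>The operator \<open>v \<partial>/\<partial>v\<close>.  It is diagonal on monomials, so it multiplies each coefficient by the
  exponent of \<open>v\<close>.\<close>

definition euler :: "'n + 'n \<Rightarrow> 'n zpoly \<Rightarrow> 'n zpoly" where
  "euler v = Poly_Mapping.mapp (\<lambda>m c. of_nat (Poly_Mapping.lookup m v) * c)"

lemma lookup_euler:
  "Poly_Mapping.lookup (euler v p) m = of_nat (Poly_Mapping.lookup m v) * Poly_Mapping.lookup p m"
  by (auto simp: euler_def lookup_mapp when_def in_keys_iff)

lemma euler_add: "euler v (p + q) = euler v p + euler v q"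
  by (intro poly_mapping_eqI) (simp add: lookup_euler lookup_add algebra_simps)

lemma euler_zero: "euler v 0 = 0"
  by (intro poly_mapping_eqI) (simp add: lookup_euler)

lemma euler_sum: "euler v (sum f A) = (\<Sum>a\<in>A. euler v (f a))"
  by (induction A rule: infinite_finite_induct) (simp_all add: euler_add euler_zero)

lemma euler_single:
  "euler v (Poly_Mapping.single m c) = Poly_Mapping.single m (of_nat (Poly_Mapping.lookup m v) * c)"
  by (intro poly_mapping_eqI) (simp add: lookup_euler lookup_single when_def)

lemma euler_mult: "euler v (p * q) = euler v p * q + p * euler v q"
proof -
  have "euler v (Poly_Mapping.single m c * Poly_Mapping.single m' c') =
      euler v (Poly_Mapping.single m c) * Poly_Mapping.single m' c' +
      Poly_Mapping.single m c * euler v (Poly_Mapping.single m' c')" for m m' c c'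
    by (simp add: mult_single euler_single lookup_add algebra_simps flip: single_add)
  then have "euler v ((\<Sum>m\<in>M. Poly_Mapping.single m (f m)) * (\<Sum>m\<in>M'. Poly_Mapping.single m (g m))) =
      euler v (\<Sum>m\<in>M. Poly_Mapping.single m (f m)) * (\<Sum>m\<in>M'. Poly_Mapping.single m (g m)) +
      (\<Sum>m\<in>M. Poly_Mapping.single m (f m)) * euler v (\<Sum>m\<in>M'. Poly_Mapping.single m (g m))"
    for M M' f g
    by (simp add: sum_product euler_sum sum.distrib)
  from this[of "Poly_Mapping.lookup p" "Poly_Mapping.keys p" "Poly_Mapping.lookup q" "Poly_Mapping.keys q"]
  show ?thesis
    by (simp only: sum_monomials[symmetric])
qed

lemma euler_Const: "euler v (Const c) = 0"
  by (simp add: Const_def euler_single)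

lemma euler_Var: "euler v (Var w) = (if v = w then Var w else 0)"
  by (simp add: Var_def euler_single lookup_single when_def)

lemma euler_power: "euler v (p ^ k) = of_nat k * p ^ (k - 1) * euler v p"
proof (induction k)
  case 0
  show ?case using euler_Const[of v 1] by (simp add: Const_one)
next
  case (Suc k)
  then show ?case by (cases k) (simp_all add: euler_mult algebra_simps)
qed

lemma perm_act_euler:
  assumes "bij \<pi>"
  shows "perm_act \<pi> (euler v p) = euler (map_sum \<pi> \<pi> v) (perm_act \<pi> p)"
proof (induction p rule: zpoly_induct)
  case (Var w)
  have "inj (map_sum \<pi> \<pi>)"
    using bij_is_inj[OF assms] by (simp add: sum.inj_map)
  then show ?case
    by (auto simp: euler_Var perm_act_simps inj_eq)
qed (simp_all add: perm_act_simps euler_Const euler_add euler_mult)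

text \<open>The real differential at \<open>z\<close> in the direction \<open>w\<close>, expressed through the logarithmic direction
  \<open>w\<^sub>j / z\<^sub>j\<close>; this is the form in which the Euler operators replace the partial derivatives.\<close>

definition peval_deriv :: "'n::finite zpoly \<Rightarrow> complex ^ 'n \<Rightarrow> complex ^ 'n \<Rightarrow> complex" where
  "peval_deriv p z w = (\<Sum>j\<in>UNIV. peval (euler (Inl j) p) z * (w $ j / z $ j) +
    peval (euler (Inr j) p) z * cnj (w $ j / z $ j))"

lemma peval_has_derivative:
  assumes nz: "\<And>j. z $ j \<noteq> 0"
  shows "(peval p has_derivative peval_deriv p z) (at z)"
proof (induction p rule: zpoly_induct)
  case (Const c)
  have const: "peval (Const c) = (\<lambda>z. c)" "peval_deriv (Const c) z = (\<lambda>w. 0)"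
    by (simp_all add: fun_eq_iff peval_deriv_def euler_Const peval_simps)
  show ?case unfolding const by (rule has_derivative_const)
next
  case (Var v)
  show ?case
  proof (cases v)
    case (Inl i)
    have "peval (Var v) = (\<lambda>z. z $ i)"
      by (simp add: fun_eq_iff peval_simps Inl)
    moreover have "peval_deriv (Var v) z w = w $ i" for w
    proof -
      have "peval_deriv (Var v) z w = (\<Sum>j\<in>UNIV. if j = i then w $ i else 0)"
        unfolding peval_deriv_def
        using nz by (intro sum.cong) (auto simp: euler_Var Inl peval_simps)
      then show ?thesis by simp
    qed
    ultimately show ?thesis
      using bounded_linear_imp_has_derivative[OF bounded_linear_vec_nth[of i]]
      by (simp add: fun_eq_iff[of "peval_deriv (Var v) z" "\<lambda>w. w $ i", THEN iffD2])
  next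
    case (Inr i)
    have "peval (Var v) = (\<lambda>z. cnj (z $ i))"
      by (simp add: fun_eq_iff peval_simps Inr)
    moreover have "peval_deriv (Var v) z w = cnj (w $ i)" for w
    proof -
      have "peval_deriv (Var v) z w = (\<Sum>j\<in>UNIV. if j = i then cnj (w $ i) else 0)"
        unfolding peval_deriv_def
        using nz by (intro sum.cong) (auto simp: euler_Var Inr peval_simps)
      then show ?thesis by simp
    qed
    ultimately show ?thesis
      using bounded_linear_imp_has_derivative[OF bounded_linear_compose[OF bounded_linear_cnj bounded_linear_vec_nth[of i]]]
      by (simp add: fun_eq_iff[of "peval_deriv (Var v) z" "\<lambda>w. cnj (w $ i)", THEN iffD2])
  qed
next
  case (add p q)
  have "peval (p + q) = (\<lambda>z. peval p z + peval q z)"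
    by (simp add: fun_eq_iff peval_simps)
  moreover have "peval_deriv (p + q) z = (\<lambda>w. peval_deriv p z w + peval_deriv q z w)"
    by (rule ext) (simp only: peval_deriv_def euler_add peval_simps distrib_left distrib_right
        sum.distrib[symmetric] ac_simps)
  ultimately show ?case
    using has_derivative_add[OF add] by (simp only:)
next
  case (mult p q)
  have "peval (p * q) = (\<lambda>z. peval p z * peval q z)"
    by (simp add: fun_eq_iff peval_simps)
  moreover have "peval_deriv (p * q) z = (\<lambda>w. peval p z * peval_deriv q z w + peval_deriv p z w * peval q z)"
    by (rule ext) (simp only: peval_deriv_def euler_mult peval_simps sum_distrib_left sum_distrib_right
        sum.distrib[symmetric] distrib_left distrib_right ac_simps)
  ultimately show ?case
    using has_derivative_mult[OF mult] by (simp only:)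
qed

section \<open>The ideal of the torus\<close>

lemma ring_of_type_algebra_simps:
  "carrier ring_of_type_algebra = UNIV" "mult ring_of_type_algebra = (*)" "add ring_of_type_algebra = (+)"
  "one ring_of_type_algebra = 1" "zero ring_of_type_algebra = 0"
  by (simp_all add: ring_of_type_algebra_def)

lemma ideal_torus_ideal: "ideal (torus_ideal :: 'n::finite zpoly set) ring_of_type_algebra"
  unfolding torus_ideal_def
  by (rule ring.genideal_ideal[OF ring_from_type_algebra]) (simp add: ring_of_type_algebra_simps)

lemma torus_ideal_zero: "0 \<in> torus_ideal"
  using additive_subgroup.zero_closed[OF ideal.axioms(1)[OF ideal_torus_ideal]] by (simp add: ring_of_type_algebra_simps)

lemma torus_ideal_add: "p \<in> torus_ideal \<Longrightarrow> q \<in> torus_ideal \<Longrightarrow> p + q \<in> torus_ideal"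
  using additive_subgroup.a_closed[OF ideal.axioms(1)[OF ideal_torus_ideal], of p q] by (simp add: ring_of_type_algebra_simps)

lemma torus_ideal_mult: "p \<in> torus_ideal \<Longrightarrow> q * p \<in> torus_ideal"
  using ideal.I_l_closed[OF ideal_torus_ideal, of p q] by (simp add: ring_of_type_algebra_simps)

lemma torus_ideal_diff: "p \<in> torus_ideal \<Longrightarrow> q \<in> torus_ideal \<Longrightarrow> p - q \<in> torus_ideal"
  using torus_ideal_add[of p "- 1 * q"] torus_ideal_mult[of q "- 1"] by simp

lemma torus_ideal_sum: "(\<And>a. a \<in> A \<Longrightarrow> f a \<in> torus_ideal) \<Longrightarrow> sum f A \<in> torus_ideal"
  by (induction A rule: infinite_finite_induct) (simp_all add: torus_ideal_zero torus_ideal_add)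

lemma elem_sym_minus_1_in_torus_ideal:
  "elem_sym CARD('n) - 1 \<in> (torus_ideal :: 'n::finite zpoly set)"
  "elem_sym_bar CARD('n) - 1 \<in> (torus_ideal :: 'n::finite zpoly set)"
proof -
  have "{elem_sym CARD('n) - 1, elem_sym_bar CARD('n) - 1} \<subseteq> (torus_ideal :: 'n zpoly set)"
    unfolding torus_ideal_def
    by (rule ring.genideal_self[OF ring_from_type_algebra]) (simp add: ring_of_type_algebra_simps)
  then show "elem_sym CARD('n) - 1 \<in> (torus_ideal :: 'n::finite zpoly set)"
    "elem_sym_bar CARD('n) - 1 \<in> (torus_ideal :: 'n::finite zpoly set)" by simp_all
qed

lemma torus_ideal_induct [consumes 1, case_names elem_sym elem_sym_bar add mult]:
  assumes "p \<in> (torus_ideal :: 'n::finite zpoly set)"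
    and gen: "P (elem_sym CARD('n) - 1)" "P (elem_sym_bar CARD('n) - 1)"
    and add: "\<And>p q. P p \<Longrightarrow> P q \<Longrightarrow> P (p + q)" and mult: "\<And>p q. P p \<Longrightarrow> P (q * p)"
  shows "P p"
proof -
  interpret R: ring "ring_of_type_algebra :: 'n zpoly ring" by (rule ring_from_type_algebra)
  have zero: "P 0" using mult[OF gen(1), of 0] by simp
  have "ideal {p. P p} ring_of_type_algebra"
  proof (rule idealI)
    show "subgroup {p. P p} (add_monoid ring_of_type_algebra)"
    proof (rule R.add.subgroupI)
      fix a assume "a \<in> {p. P p}"
      then have "P (- a)" using mult[of a "- 1"] by simp
      moreover have "\<ominus>\<^bsub>ring_of_type_algebra\<^esub> a = - a"
        by (rule R.minus_equality) (simp_all add: ring_of_type_algebra_simps)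
      ultimately show "\<ominus>\<^bsub>ring_of_type_algebra\<^esub> a \<in> {p. P p}" by simp
    qed (use zero add in \<open>auto simp: ring_of_type_algebra_simps\<close>)
  qed (use mult in \<open>auto simp: ring_of_type_algebra_simps mult.commute R.ring_axioms\<close>)
  then have "torus_ideal \<subseteq> {p. P p}"
    unfolding torus_ideal_def by (rule R.genideal_minimal) (use gen in auto)
  then show ?thesis using assms(1) by auto
qed

lemma elem_sym_card: "elem_sym CARD('n) = (\<Prod>j\<in>UNIV. Var (Inl j :: 'n::finite + 'n))"
  and elem_sym_bar_card: "elem_sym_bar CARD('n) = (\<Prod>j\<in>UNIV. Var (Inr j :: 'n::finite + 'n))"
proof -
  have "{S :: 'n set. card S = CARD('n)} = {UNIV}"
    by (auto dest: card_eq_UNIV_imp_eq_UNIV[rotated])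
  then show "elem_sym CARD('n) = (\<Prod>j\<in>UNIV. Var (Inl j :: 'n + 'n))"
    "elem_sym_bar CARD('n) = (\<Prod>j\<in>UNIV. Var (Inr j :: 'n + 'n))"
    by (simp_all add: elem_sym_def elem_sym_bar_def)
qed

lemma peval_torus_ideal:
  assumes "p \<in> torus_ideal" "z \<in> torus"
  shows "peval p z = 0"
  using assms(1)
proof (induction p rule: torus_ideal_induct)
  case elem_sym_bar
  have "(\<Prod>j\<in>UNIV. cnj (z $ j)) = 1"
    using assms(2) by (simp add: torus_def flip: cnj_prod)
  then show ?case by (simp add: elem_sym_bar_card peval_simps)
qed (use assms(2) in \<open>simp_all add: elem_sym_card peval_simps torus_def\<close>)

text \<open>Dedekind's argument: if \<open>\<omega>\<close> and \<open>\<alpha>\<close> differ at \<open>t\<close>, then the relation translated by \<open>t\<close> minus \<open>\<alpha> t\<close>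
  times the relation itself no longer involves \<open>\<alpha>\<close> but still involves \<open>\<omega>\<close>.  Characters are
  extensional on \<open>G\<close>, so that distinct ones differ at a point of \<open>G\<close>.\<close>

lemma characters_independent:
  fixes C :: "('g \<Rightarrow> 'b::idom) set"
  assumes "finite C"
    and closed: "\<And>s t. s \<in> G \<Longrightarrow> t \<in> G \<Longrightarrow> mul s t \<in> G"
    and mult: "\<And>\<omega> s t. \<omega> \<in> C \<Longrightarrow> s \<in> G \<Longrightarrow> t \<in> G \<Longrightarrow> \<omega> (mul s t) = \<omega> s * \<omega> t"
    and nonzero: "\<And>\<omega>. \<omega> \<in> C \<Longrightarrow> \<exists>s\<in>G. \<omega> s \<noteq> 0"
    and ext: "C \<subseteq> extensional G"
    and relation: "\<And>s. s \<in> G \<Longrightarrow> (\<Sum>\<omega>\<in>C. c \<omega> * \<omega> s) = 0"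
    and "\<omega> \<in> C"
  shows "c \<omega> = 0"
  using assms(1,3-)
proof (induction C arbitrary: c \<omega>)
  case empty
  then show ?case by simp
next
  case (insert \<alpha> C)
  have rest: "c \<omega> = 0" if "\<omega> \<in> C" for \<omega>
  proof -
    have "\<omega> = \<alpha>" if "\<And>t. t \<in> G \<Longrightarrow> \<omega> t = \<alpha> t"
      using insert.prems(3) \<open>\<omega> \<in> C\<close> that by (intro extensionalityI[of \<omega> G \<alpha>]) auto
    then obtain t where t: "t \<in> G" "\<omega> t \<noteq> \<alpha> t"
      using insert.hyps \<open>\<omega> \<in> C\<close> by blast
    have "(\<Sum>\<psi>\<in>C. c \<psi> * (\<psi> t - \<alpha> t) * \<psi> s) = 0" if "s \<in> G" for s
    proof -
      have "(\<Sum>\<psi>\<in>C. c \<psi> * (\<psi> t - \<alpha> t) * \<psi> s) =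
          (\<Sum>\<psi>\<in>insert \<alpha> C. c \<psi> * (\<psi> t * \<psi> s)) - \<alpha> t * (\<Sum>\<psi>\<in>insert \<alpha> C. c \<psi> * \<psi> s)"
        using insert.hyps by (simp add: algebra_simps sum_subtractf sum_distrib_left)
      also have "(\<Sum>\<psi>\<in>insert \<alpha> C. c \<psi> * (\<psi> t * \<psi> s)) = (\<Sum>\<psi>\<in>insert \<alpha> C. c \<psi> * \<psi> (mul t s))"
        using insert.prems(1) t(1) that by simp
      finally show ?thesis
        using insert.prems(4) closed t(1) that by simp
    qed
    then have "c \<omega> * (\<omega> t - \<alpha> t) = 0"
      using insert.prems that by (intro insert.IH[where c = "\<lambda>\<psi>. c \<psi> * (\<psi> t - \<alpha> t)"]) auto
    then show ?thesis using t(2) by simp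
  qed
  obtain s where s: "s \<in> G" "\<alpha> s \<noteq> 0" using insert.prems(2)[of \<alpha>] by auto
  have "c \<alpha> * \<alpha> s = 0"
    using insert.prems(4)[OF s(1)] insert.hyps rest by simp
  then have "c \<alpha> = 0" using s(2) by simp
  with rest insert.prems(5) show ?case by auto
qed

text \<open>The function that the monomial with exponents \<open>m\<close> defines.  On the torus it is a homomorphism
  to the nonzero complex numbers.\<close>

definition character :: "('n::finite + 'n \<Rightarrow>\<^sub>0 nat) \<Rightarrow> complex ^ 'n \<Rightarrow> complex" where
  "character m z = (\<Prod>j\<in>UNIV. (z $ j) ^ Poly_Mapping.lookup m (Inl j)) *
    (\<Prod>j\<in>UNIV. cnj (z $ j) ^ Poly_Mapping.lookup m (Inr j))"

lemma prod_UNIV_sum: "(\<Prod>v\<in>UNIV. f v) = (\<Prod>j\<in>UNIV. f (Inl j)) * (\<Prod>j\<in>UNIV. f (Inr j))"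
  for f :: "'a::finite + 'b::finite \<Rightarrow> 'c::comm_monoid_mult"
  by (simp add: prod.Plus flip: UNIV_Plus_UNIV)

lemma peval_single: "peval (Poly_Mapping.single m c) z = c * character m z"
  by (simp add: peval_def eval.psubst_single prod_UNIV_sum character_def)

text \<open>Real \<open>s\<close> detects \<open>a + b\<close>, and \<open>s\<close> on the unit circle detects \<open>a - b\<close>.\<close>

lemma complex_power_cnj_power_eqD:
  assumes "\<And>s::complex. s \<noteq> 0 \<Longrightarrow> s ^ a * cnj s ^ b = s ^ c * cnj s ^ d"
  shows "a = c \<and> b = d"
proof -
  have "(2::complex) ^ (a + b) = 2 ^ (c + d)"
    using assms[of 2] by (simp add: power_add)
  then have "(2::nat) ^ (a + b) = 2 ^ (c + d)"
    by (metis of_nat_eq_iff of_nat_numeral of_nat_power)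
  then have sum: "a + b = c + d" by simp
  \<comment> \<open>The angle is chosen small enough that \<open>cis (e * \<theta>) = 1\<close> forces \<open>e * \<theta> = 0\<close>.\<close>
  define e where "e = real a + real d - real b - real c"
  define \<theta> where "\<theta> = 1 / (1 + \<bar>e\<bar>)"
  have "cis (real a * \<theta> + real b * - \<theta>) = cis (real c * \<theta> + real d * - \<theta>)"
    using assms[of "cis \<theta>", OF cis_neq_zero] by (simp only: cis_cnj Complex.DeMoivre cis_mult)
  moreover have "e * \<theta> = (real a * \<theta> + real b * - \<theta>) - (real c * \<theta> + real d * - \<theta>)"
    by (simp add: e_def left_diff_distrib distrib_right)
  ultimately have "cis (e * \<theta>) = 1"
    by (simp only: cis_divide[symmetric] divide_self[OF cis_neq_zero])
  then have "sin (e * \<theta>) = 0" by (simp add: complex_eq_iff)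
  moreover have "\<bar>e * \<theta>\<bar> < 1"
    by (simp add: \<theta>_def abs_mult)
  then have "- pi < e * \<theta>" "e * \<theta> < pi"
    using pi_gt3 by linarith+
  ultimately have "e * \<theta> = 0"
    using sin_eq_0_pi by blast
  then have "e = 0" by (auto simp: \<theta>_def)
  then have "a + d = b + c" by (simp add: e_def flip: of_nat_add)
  with sum show ?thesis by simp
qed

text \<open>Two monomials with the same character have exponents that differ by one constant in the \<open>z\<^sub>j\<close>
  and by another in their conjugates.  The points of the torus with coordinates \<open>s\<close> at \<open>j\<close>,
  \<open>1/s\<close> at \<open>k\<close> and \<open>1\<close> elsewhere show this; the equations are stated additively to avoid
  subtraction of natural numbers.\<close>

lemma character_eq_imp_exponents:
  fixes m m' :: "'n::finite + 'n \<Rightarrow>\<^sub>0 nat"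
  assumes eq: "\<And>z. z \<in> torus \<Longrightarrow> character m z = character m' z"
  shows "Poly_Mapping.lookup m (Inl j) + Poly_Mapping.lookup m' (Inl k) =
      Poly_Mapping.lookup m' (Inl j) + Poly_Mapping.lookup m (Inl k) \<and>
    Poly_Mapping.lookup m (Inr j) + Poly_Mapping.lookup m' (Inr k) =
      Poly_Mapping.lookup m' (Inr j) + Poly_Mapping.lookup m (Inr k)"
proof (cases "j = k")
  case False
  have two: "(\<Prod>i\<in>UNIV. (if i = j then s else if i = k then inverse s else 1) ^ f i) = s ^ f j * inverse s ^ f k"
    for s :: complex and f :: "'n \<Rightarrow> nat"
  proof -
    have "(\<Prod>i\<in>UNIV. (if i = j then s else if i = k then inverse s else 1) ^ f i) =
        (\<Prod>i\<in>UNIV. (if i = j then s ^ f j else 1) * (if i = k then inverse s ^ f k else 1))"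
      using False by (intro prod.cong) auto
    then show ?thesis by (simp add: prod.distrib)
  qed
  show ?thesis
  proof (rule complex_power_cnj_power_eqD)
    fix s :: complex assume s: "s \<noteq> 0"
    define z :: "complex ^ 'n" where "z = (\<chi> i. if i = j then s else if i = k then inverse s else 1)"
    have chr: "character m z = s ^ Poly_Mapping.lookup m (Inl j) * inverse s ^ Poly_Mapping.lookup m (Inl k) *
        (cnj s ^ Poly_Mapping.lookup m (Inr j) * inverse (cnj s) ^ Poly_Mapping.lookup m (Inr k))" for m
      by (simp add: character_def z_def two if_distrib[of cnj] cong: if_cong)
    have "z \<in> torus"
      using two[of s "\<lambda>_. 1"] s by (simp add: torus_def z_def)
    from eq[OF this, unfolded chr] s
    show "s ^ (Poly_Mapping.lookup m (Inl j) + Poly_Mapping.lookup m' (Inl k)) *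
          cnj s ^ (Poly_Mapping.lookup m (Inr j) + Poly_Mapping.lookup m' (Inr k)) =
        s ^ (Poly_Mapping.lookup m' (Inl j) + Poly_Mapping.lookup m (Inl k)) *
          cnj s ^ (Poly_Mapping.lookup m' (Inr j) + Poly_Mapping.lookup m (Inr k))"
      by (simp add: power_add field_simps)
  qed
qed simp

text \<open>Exponents that differ by a constant become equal after multiplication with suitable powers of
  \<open>\<sigma>\<^sub>n\<close>, which is congruent to \<open>1\<close>; likewise for the conjugates.\<close>

lemma character_eq_imp_diff_in_torus_ideal:
  fixes m m' :: "'n::finite + 'n \<Rightarrow>\<^sub>0 nat"
  assumes eq: "\<And>z. z \<in> torus \<Longrightarrow> character m z = character m' z"
  shows "Poly_Mapping.single m c - Poly_Mapping.single m' c \<in> torus_ideal"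
proof -
  have part: "(\<Prod>j\<in>UNIV. x j ^ f j) - (\<Prod>j\<in>UNIV. x j ^ g j) \<in> torus_ideal"
    if gen: "(\<Prod>j\<in>UNIV. x j) - 1 \<in> torus_ideal" and fg: "\<And>j k. f j + g k = g j + f k"
    for x :: "'n \<Rightarrow> 'n zpoly" and f g
  proof -
    let ?\<sigma> = "\<Prod>j\<in>UNIV. x j"
    have power: "?\<sigma> ^ k - 1 \<in> torus_ideal" for k
    proof (induction k)
      case (Suc k)
      have step: "?\<sigma> ^ Suc k - 1 = ?\<sigma> * (?\<sigma> ^ k - 1) + (?\<sigma> - 1)" by (simp add: algebra_simps)
      show ?case unfolding step by (intro torus_ideal_add torus_ideal_mult Suc gen)
    qed (simp add: torus_ideal_zero)
    have "(\<Prod>j\<in>UNIV. x j ^ f j) * ?\<sigma> ^ g k = (\<Prod>j\<in>UNIV. x j ^ g j) * ?\<sigma> ^ f k" for k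
      by (simp only: prod_power_distrib prod.distrib[symmetric] power_add[symmetric] fg)
    then have decomp: "(\<Prod>j\<in>UNIV. x j ^ f j) - (\<Prod>j\<in>UNIV. x j ^ g j) =
        (\<Prod>j\<in>UNIV. x j ^ g j) * (?\<sigma> ^ f k - 1) - (\<Prod>j\<in>UNIV. x j ^ f j) * (?\<sigma> ^ g k - 1)"
      for k by (simp add: algebra_simps)
    \<comment> \<open>Any index serves as the reference \<open>k\<close>.\<close>
    show ?thesis
      unfolding decomp[of undefined] by (intro torus_ideal_diff torus_ideal_mult power)
  qed
  define A B where "A m = (\<Prod>j\<in>UNIV. Var (Inl j) ^ Poly_Mapping.lookup m (Inl j))"
    and "B m = (\<Prod>j\<in>UNIV. Var (Inr j) ^ Poly_Mapping.lookup m (Inr j))" for m :: "'n + 'n \<Rightarrow>\<^sub>0 nat"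
  have "A m - A m' \<in> torus_ideal" "B m - B m' \<in> torus_ideal"
    using elem_sym_minus_1_in_torus_ideal[where 'n = 'n] character_eq_imp_exponents[OF eq]
    unfolding A_def B_def by (auto intro!: part simp: elem_sym_card elem_sym_bar_card)
  then have "(Const c * B m) * (A m - A m') + (Const c * A m') * (B m - B m') \<in> torus_ideal"
    by (intro torus_ideal_add torus_ideal_mult)
  also have "(Const c * B m) * (A m - A m') + (Const c * A m') * (B m - B m') =
      Poly_Mapping.single m c - Poly_Mapping.single m' c"
    by (simp add: single_eq_Const_prod_Var prod_UNIV_sum A_def[symmetric] B_def[symmetric] algebra_simps)
  finally show ?thesis .
qed

text \<open>Group the monomials of \<open>p\<close> by their characters.  Independence makes the coefficients in each group
  sum to zero, and the monomials of one group are congruent modulo the ideal, so each group lies in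
  the ideal.\<close>

lemma vanishing_on_torus_imp_torus_ideal:
  assumes vanish: "\<And>z. z \<in> torus \<Longrightarrow> peval p z = 0"
  shows "p \<in> torus_ideal"
proof -
  define K where "K = Poly_Mapping.keys p"
  define \<psi> where "\<psi> m = restrict (character m) torus" for m :: "'a + 'a \<Rightarrow>\<^sub>0 nat"
  have fin: "finite K" by (simp add: K_def)
  let ?class = "\<lambda>\<omega>. {m \<in> K. \<psi> m = \<omega>}"
  have coeff: "(\<Sum>m\<in>?class \<omega>. Poly_Mapping.lookup p m) = 0" if "\<omega> \<in> \<psi> ` K" for \<omega>
  proof (rule characters_independent[where C = "\<psi> ` K" and G = torus and mul = "(*)"
        and c = "\<lambda>\<omega>. \<Sum>m\<in>?class \<omega>. Poly_Mapping.lookup p m"])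
    show closed: "s * t \<in> torus" if "s \<in> torus" "t \<in> torus" for s t :: "complex ^ 'a"
      using that by (simp add: torus_def prod.distrib)
    show "\<omega> (s * t) = \<omega> s * \<omega> t" if "\<omega> \<in> \<psi> ` K" "s \<in> torus" "t \<in> torus" for \<omega> s t
      using that closed[OF that(2,3)]
      by (auto simp: \<psi>_def character_def power_mult_distrib prod.distrib)
    show "\<exists>s\<in>torus. \<omega> s \<noteq> 0" if "\<omega> \<in> \<psi> ` K" for \<omega>
      using that by (intro bexI[of _ "\<chi> j. 1"]) (auto simp: \<psi>_def character_def torus_def)
    show "(\<Sum>\<omega>\<in>\<psi> ` K. (\<Sum>m\<in>?class \<omega>. Poly_Mapping.lookup p m) * \<omega> s) = 0" if "s \<in> torus" for s
    proof -
      have "(\<Sum>m\<in>?class \<omega>. Poly_Mapping.lookup p m) * \<omega> s =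
          (\<Sum>m\<in>?class \<omega>. Poly_Mapping.lookup p m * character m s)" for \<omega>
        using that by (auto simp: sum_distrib_right \<psi>_def intro!: sum.cong)
      then have "(\<Sum>\<omega>\<in>\<psi> ` K. (\<Sum>m\<in>?class \<omega>. Poly_Mapping.lookup p m) * \<omega> s) =
          (\<Sum>m\<in>K. Poly_Mapping.lookup p m * character m s)"
        using sum.image_gen[OF fin, of "\<lambda>m. Poly_Mapping.lookup p m * character m s" \<psi>] by simp
      also have "\<dots> = peval p s"
        by (subst (2) sum_monomials) (simp add: peval_simps(3) peval_single K_def)
      finally show ?thesis using vanish[OF that] by simp
    qed
  qed (use fin that in \<open>auto simp: \<psi>_def\<close>)
  have "(\<Sum>m\<in>?class \<omega>. Poly_Mapping.single m (Poly_Mapping.lookup p m)) \<in> torus_ideal"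
    if \<omega>: "\<omega> \<in> \<psi> ` K" for \<omega>
  proof -
    obtain n where n: "\<psi> n = \<omega>" using \<omega> by auto
    have "(\<Sum>m\<in>?class \<omega>. Poly_Mapping.single n (Poly_Mapping.lookup p m)) =
        Poly_Mapping.single n (\<Sum>m\<in>?class \<omega>. Poly_Mapping.lookup p m)"
      by (intro poly_mapping_eqI) (simp add: lookup_sum lookup_single when_def)
    then have "(\<Sum>m\<in>?class \<omega>. Poly_Mapping.single m (Poly_Mapping.lookup p m)) =
        (\<Sum>m\<in>?class \<omega>. Poly_Mapping.single m (Poly_Mapping.lookup p m) -
          Poly_Mapping.single n (Poly_Mapping.lookup p m))"
      using coeff[OF \<omega>] by (simp add: sum_subtractf)
    moreover have "character m z = character n z" if m: "\<psi> m = \<omega>" and z: "z \<in> torus" for m z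
    proof -
      have "\<psi> m z = \<psi> n z" by (simp only: m n)
      then show ?thesis using z by (simp add: \<psi>_def)
    qed
    ultimately show ?thesis
      by (auto intro!: torus_ideal_sum character_eq_imp_diff_in_torus_ideal)
  qed
  then have "(\<Sum>\<omega>\<in>\<psi> ` K. \<Sum>m\<in>?class \<omega>. Poly_Mapping.single m (Poly_Mapping.lookup p m)) \<in> torus_ideal"
    by (rule torus_ideal_sum)
  then have "(\<Sum>m\<in>K. Poly_Mapping.single m (Poly_Mapping.lookup p m)) \<in> torus_ideal"
    using sum.image_gen[OF fin, of "\<lambda>m. Poly_Mapping.single m (Poly_Mapping.lookup p m)" \<psi>] by simp
  then show ?thesis
    unfolding K_def sum_monomials[symmetric] .
qed

section \<open>The symplectic form in logarithmic coordinates\<close>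

lemma has_derivative_ln_cmod:
  assumes "z \<noteq> 0"
  shows "((\<lambda>z. ln (cmod z)) has_derivative (\<lambda>w. Re (w / z))) (at z)"
proof -
  have "((\<lambda>z. ln (cmod z)) has_derivative (\<lambda>w. (w \<bullet> sgn z) / cmod z)) (at z)"
    using assms by (auto intro!: derivative_eq_intros has_derivative_norm simp: divide_inverse)
  moreover have "(w \<bullet> sgn z) / cmod z = Re (w / z)" for w
    unfolding inner_complex_def Re_divide cmod_power2[symmetric]
    by (simp add: power2_eq_square add_divide_distrib)
  ultimately show ?thesis by simp
qed

lemma wirtinger_bar_log_square:
  fixes z :: "complex ^ 'n::finite"
  assumes nz: "\<And>j. z $ j \<noteq> 0"
  shows "wirtinger_bar k (\<lambda>u. complex_of_real (\<Sum>j\<in>UNIV. (ln (cmod (u $ j)))\<^sup>2)) z =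
    complex_of_real (ln (cmod (z $ k))) * inverse (cnj (z $ k))"
proof -
  have D: "((\<lambda>u::complex ^ 'n. ln (cmod (u $ j))) has_derivative (\<lambda>w. Re (w $ j / z $ j))) (at z)" for j
    using diff_chain_at[OF bounded_linear_imp_has_derivative[OF bounded_linear_vec_nth[of j]]
        has_derivative_ln_cmod[OF nz[of j]]]
    by (simp add: o_def)
  have "((\<lambda>u. complex_of_real (\<Sum>j\<in>UNIV. (ln (cmod (u $ j)))\<^sup>2)) has_derivative
      (\<lambda>w. complex_of_real (\<Sum>j\<in>UNIV. 2 * ln (cmod (z $ j)) * Re (w $ j / z $ j)))) (at z)"
    by (intro has_derivative_of_real has_derivative_eq_rhs[OF has_derivative_sum[OF has_derivative_power[OF D]]])
      (simp add: fun_eq_iff mult_ac)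
  note frechet = frechet_derivative_at[OF this, symmetric]
  have sum_axis: "(\<Sum>j\<in>UNIV. 2 * ln (cmod (z $ j)) * Re (axis k c $ j / z $ j)) =
      2 * ln (cmod (z $ k)) * Re (c / z $ k)" for c
  proof -
    have "(\<Sum>j\<in>UNIV. 2 * ln (cmod (z $ j)) * Re (axis k c $ j / z $ j)) =
        (\<Sum>j\<in>UNIV. if j = k then 2 * ln (cmod (z $ k)) * Re (c / z $ k) else 0)"
      by (intro sum.cong) (auto simp: axis_def)
    then show ?thesis by simp
  qed
  have "complex_of_real (Re a) + \<i> * complex_of_real (Re (\<i> * a)) = cnj a" for a
    by (simp add: complex_eq_iff)
  from this[of "inverse (z $ k)"]
  have "complex_of_real (Re (1 / z $ k)) + \<i> * complex_of_real (Re (\<i> / z $ k)) = inverse (cnj (z $ k))"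
    by (simp only: divide_inverse mult_1_left complex_cnj_inverse)
  from this[symmetric] show ?thesis
    unfolding wirtinger_bar_def frechet sum_axis by (simp only:) (simp add: field_simps)
qed

lemma wirtinger_wirtinger_bar_log_square:
  fixes z :: "complex ^ 'n::finite"
  assumes nz: "\<And>j. z $ j \<noteq> 0"
  shows "wirtinger j (wirtinger_bar k (\<lambda>u. complex_of_real (\<Sum>j\<in>UNIV. (ln (cmod (u $ j)))\<^sup>2))) z =
    (if j = k then inverse (2 * z $ k * cnj (z $ k)) else 0)" (is "wirtinger j ?f z = _")
proof -
  define U where "U = (\<Inter>j. {u :: complex ^ 'n. u $ j \<noteq> 0})"
  have "open U"
    unfolding U_def by (intro open_INT ballI open_Collect_neq continuous_intros) auto
  have "((\<lambda>u. ln (cmod (u $ k))) has_derivative (\<lambda>w. Re (w $ k / z $ k))) (at z)"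
    using diff_chain_at[OF bounded_linear_imp_has_derivative[OF bounded_linear_vec_nth[of k]]
        has_derivative_ln_cmod[OF nz[of k]]]
    by (simp add: o_def)
  moreover have "((\<lambda>u. cnj (u $ k)) has_derivative (\<lambda>w. cnj (w $ k))) (at z)"
    by (intro bounded_linear_imp_has_derivative
        bounded_linear_compose[OF bounded_linear_cnj bounded_linear_vec_nth])
  ultimately have D: "((\<lambda>u. complex_of_real (ln (cmod (u $ k))) * inverse (cnj (u $ k))) has_derivative
      (\<lambda>w. complex_of_real (ln (cmod (z $ k))) * - (inverse (cnj (z $ k)) * cnj (w $ k) * inverse (cnj (z $ k))) +
        complex_of_real (Re (w $ k / z $ k)) * inverse (cnj (z $ k)))) (at z)"
    using nz by (intro has_derivative_mult has_derivative_of_real Deriv.has_derivative_inverse) auto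
  have eq: "complex_of_real (ln (cmod (u $ k))) * inverse (cnj (u $ k)) = ?f u" if "u \<in> U" for u
    using that by (intro wirtinger_bar_log_square[symmetric]) (auto simp: U_def)
  have "z \<in> U" using nz by (simp add: U_def)
  have "(?f has_derivative
      (\<lambda>w. complex_of_real (ln (cmod (z $ k))) * - (inverse (cnj (z $ k)) * cnj (w $ k) * inverse (cnj (z $ k))) +
        complex_of_real (Re (w $ k / z $ k)) * inverse (cnj (z $ k)))) (at z)"
    by (rule has_derivative_transform_within_open[OF D \<open>open U\<close> \<open>z \<in> U\<close> eq])
  note frechet = frechet_derivative_at[OF this, symmetric]
  show ?thesis
  proof (cases "j = k")
    case True
    have "complex_of_real (Re a) - \<i> * complex_of_real (Re (\<i> * a)) = a" for a
      by (simp add: complex_eq_iff)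
    from this[of "inverse (z $ k)"]
    have "complex_of_real (Re (1 / z $ k)) - \<i> * complex_of_real (Re (\<i> / z $ k)) = inverse (z $ k)"
      by (simp only: divide_inverse mult_1_left)
    then have "(complex_of_real (Re (1 / z $ k)) - \<i> * complex_of_real (Re (\<i> / z $ k))) * inverse (cnj (z $ k)) / 2 =
        inverse (2 * z $ k * cnj (z $ k))" by simp
    then show ?thesis
      unfolding wirtinger_def frechet using True by (simp add: axis_def algebra_simps)
  next
    case False
    then show ?thesis
      unfolding wirtinger_def frechet by (simp add: axis_def)
  qed
qed

text \<open>In the coordinates \<open>v\<^sub>j / z\<^sub>j = x\<^sub>j + \<i> y\<^sub>j\<close> this is the standard form \<open>\<Sum>\<^sub>j dx\<^sub>j \<and> dy\<^sub>j\<close>: the potential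
  \<open>log\<^sup>2 |z\<^sub>j|\<close> has the mixed second derivative \<open>1 / (2 |z\<^sub>j|\<^sup>2)\<close>.\<close>

lemma sympl_log_coordinates:
  fixes z :: "complex ^ 'n::finite"
  assumes nz: "\<And>j. z $ j \<noteq> 0"
  shows "sympl z v w = - (\<Sum>j\<in>UNIV. Im (v $ j / z $ j * cnj (w $ j / z $ j)))"
proof -
  have "sympl z v w = Re (\<i> * (\<Sum>j\<in>UNIV. inverse (2 * z $ j * cnj (z $ j)) *
      (v $ j * cnj (w $ j) - w $ j * cnj (v $ j))))"
  proof -
    have "(\<Sum>k\<in>UNIV. (if j = k then inverse (2 * z $ k * cnj (z $ k)) else 0) *
        (v $ j * cnj (w $ k) - w $ j * cnj (v $ k))) =
        (\<Sum>k\<in>UNIV. if k = j then inverse (2 * z $ j * cnj (z $ j)) *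
        (v $ j * cnj (w $ j) - w $ j * cnj (v $ j)) else 0)" for j
      by (intro sum.cong) auto
    then have "(\<Sum>k\<in>UNIV. (if j = k then inverse (2 * z $ k * cnj (z $ k)) else 0) *
        (v $ j * cnj (w $ k) - w $ j * cnj (v $ k))) = inverse (2 * z $ j * cnj (z $ j)) * (v $ j * cnj (w $ j) - w $ j * cnj (v $ j))" for j
      by (simp only: sum.delta[OF finite] UNIV_I if_True)
    then show ?thesis
      unfolding sympl_def i_ddbar_def wirtinger_wirtinger_bar_log_square[OF nz] by (simp only:)
  qed
  also have "\<dots> = (\<Sum>j\<in>UNIV. Re (\<i> * (inverse (2 * z $ j * cnj (z $ j)) *
      (v $ j * cnj (w $ j) - w $ j * cnj (v $ j)))))"
    by (simp only: sum_distrib_left Re_sum)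
  also have "\<dots> = (\<Sum>j\<in>UNIV. - Im (v $ j / z $ j * cnj (w $ j / z $ j)))"
  proof (rule sum.cong)
    fix j
    define a b where "a = v $ j / z $ j" and "b = w $ j / z $ j"
    have ab: "v $ j = a * z $ j" "w $ j = b * z $ j" by (simp_all add: a_def b_def nz)
    have "inverse (2 * z $ j * cnj (z $ j)) * (v $ j * cnj (w $ j) - w $ j * cnj (v $ j)) =
        (a * cnj b - b * cnj a) / 2"
      unfolding ab using nz[of j] by (simp add: field_simps)
    moreover have "Re (\<i> * ((a * cnj b - b * cnj a) / 2)) = - Im (a * cnj b)"
      by (simp add: algebra_simps)
    ultimately show "Re (\<i> * (inverse (2 * z $ j * cnj (z $ j)) * (v $ j * cnj (w $ j) - w $ j * cnj (v $ j)))) =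
        - Im (v $ j / z $ j * cnj (w $ j / z $ j))"
      by (simp only: a_def b_def)
  qed simp
  finally show ?thesis by (simp add: sum_negf)
qed

lemma torus_nonzero: "z \<in> torus \<Longrightarrow> z $ j \<noteq> 0"
  using prod_zero[of UNIV "\<lambda>j. z $ j"] by (auto simp: torus_def)

lemma torus_tangent_log_coordinates:
  assumes z: "z \<in> torus"
  shows "torus_tangent z = {v. (\<Sum>j\<in>UNIV. v $ j / z $ j) = 0}"
proof -
  have "((\<lambda>u. \<Prod>j\<in>UNIV. u $ j) has_derivative
      (\<lambda>w. \<Sum>j\<in>UNIV. w $ j * (\<Prod>i\<in>UNIV - {j}. z $ i))) (at z)"
    by (intro has_derivative_prod bounded_linear_imp_has_derivative bounded_linear_vec_nth)
  moreover have "(\<Prod>i\<in>UNIV - {j}. z $ i) = 1 / z $ j" for j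
    using z torus_nonzero[OF z, of j] prod.remove[of UNIV j "\<lambda>i. z $ i"]
    by (simp add: torus_def field_simps)
  ultimately have "((\<lambda>u. \<Prod>j\<in>UNIV. u $ j) has_derivative (\<lambda>w. \<Sum>j\<in>UNIV. w $ j / z $ j)) (at z)"
    by simp
  from frechet_derivative_at[OF this, symmetric] show ?thesis
    by (simp add: torus_tangent_def)
qed

text \<open>The orthogonal projection to the hyperplane of vectors with coordinate sum \<open>0\<close>, that is, to the
  tangent space of the torus in logarithmic coordinates.\<close>

definition centred :: "('n::finite \<Rightarrow> complex) \<Rightarrow> 'n \<Rightarrow> complex" where
  "centred g j = g j - (\<Sum>k\<in>UNIV. g k) / of_nat CARD('n)"

lemma sum_centred: "(\<Sum>j\<in>UNIV. centred g j) = 0"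
  by (simp add: centred_def sum_subtractf)

lemma sum_centred_mult:
  assumes "(\<Sum>j\<in>UNIV. a j) = 0"
  shows "(\<Sum>j\<in>UNIV. centred g j * a j) = (\<Sum>j\<in>UNIV. g j * a j)"
  unfolding centred_def left_diff_distrib sum_subtractf sum_distrib_left[symmetric] assms by simp

text \<open>A real differential is \<open>Re (\<Sum>\<^sub>j g\<^sub>j w\<^sub>j)\<close> in logarithmic coordinates.  On the hyperplane only the
  centred part of \<open>g\<close> matters, and \<open>- \<i> cnj\<close> turns it into a vector that the symplectic form maps
  back to the differential.  The vector is unique because pairing the difference \<open>d\<close> of two
  candidates with \<open>\<i> d\<close> gives \<open>\<Sum>\<^sub>j |d\<^sub>j|\<^sup>2\<close>.\<close>

lemma ham_vector_torus:
  fixes z :: "complex ^ 'n::finite"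
  assumes z: "z \<in> torus"
    and df: "\<And>v. frechet_derivative f (at z) v = Re (\<Sum>j\<in>UNIV. g j * (v $ j / z $ j))"
  shows "ham_vector (torus_tangent z) f z = (\<chi> j. z $ j * (- \<i> * cnj (centred g j)))" (is "_ = ?x")
  unfolding ham_vector_def
proof (rule the_equality)
  note nz = torus_nonzero[OF z]
  have "(\<Sum>j\<in>UNIV. ?x $ j / z $ j) = - \<i> * cnj (\<Sum>j\<in>UNIV. centred g j)"
    using nz by (simp add: sum_distrib_left sum_negf)
  then have x: "?x \<in> torus_tangent z"
    by (simp add: torus_tangent_log_coordinates[OF z] sum_centred)
  have sympl: "sympl z ?x v = frechet_derivative f (at z) v" if v: "v \<in> torus_tangent z" for v
  proof -
    have "sympl z ?x v = Re (\<Sum>j\<in>UNIV. centred g j * (v $ j / z $ j))"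
    proof -
      have "- Im (- \<i> * cnj c * cnj a) = Re (c * a)" for c a by simp
      moreover have "?x $ j / z $ j = - \<i> * cnj (centred g j)" for j using nz by simp
      ultimately show ?thesis
        unfolding sympl_log_coordinates[OF nz] Re_sum sum_negf[symmetric] by (simp only:)
    qed
    also have "(\<Sum>j\<in>UNIV. centred g j * (v $ j / z $ j)) = (\<Sum>j\<in>UNIV. g j * (v $ j / z $ j))"
      using v by (intro sum_centred_mult) (simp add: torus_tangent_log_coordinates[OF z])
    also have "Re \<dots> = frechet_derivative f (at z) v"
      by (simp only: df)
    finally show ?thesis .
  qed
  show "?x \<in> torus_tangent z \<and> (\<forall>v\<in>torus_tangent z. sympl z ?x v = frechet_derivative f (at z) v)"
    using x sympl by blast
  show "y = ?x"
    if y: "y \<in> torus_tangent z \<and> (\<forall>v\<in>torus_tangent z. sympl z y v = frechet_derivative f (at z) v)" for y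
  proof -
    define d where "d j = (y $ j - ?x $ j) / z $ j" for j
    define v where "v = (\<chi> j. z $ j * (\<i> * d j))"
    have "(\<Sum>j\<in>UNIV. d j) = 0"
      using x y unfolding torus_tangent_log_coordinates[OF z] d_def diff_divide_distrib sum_subtractf mem_Collect_eq
      by (elim conjE) (simp only: diff_self)
    then have v: "v \<in> torus_tangent z"
      using nz by (simp add: torus_tangent_log_coordinates[OF z] v_def flip: sum_distrib_left)
    have "0 = sympl z y v - sympl z ?x v"
      using y v sympl by simp
    also have "\<dots> = - (\<Sum>j\<in>UNIV. Im (d j * cnj (v $ j / z $ j)))"
      unfolding sympl_log_coordinates[OF nz]
      by (simp only: d_def diff_divide_distrib left_diff_distrib minus_complex.simps sum_subtractf)
    also have "\<dots> = (\<Sum>j\<in>UNIV. (cmod (d j))\<^sup>2)"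
    proof -
      have "- Im (c * cnj (\<i> * c)) = (cmod c)\<^sup>2" for c
        unfolding cmod_power2 by (simp add: power2_eq_square)
      moreover have "v $ j / z $ j = \<i> * d j" for j
        using nz by (simp add: v_def)
      ultimately show ?thesis
        by (simp only: sum_negf[symmetric])
    qed
    finally have "d j = 0" for j
      using sum_nonneg_eq_0_iff[of UNIV "\<lambda>j. (cmod (d j))\<^sup>2"] by auto
    then have "y $ j = ?x $ j" for j
      using nz[of j] unfolding d_def divide_eq_0_iff right_minus_eq by blast
    then show ?thesis
      unfolding vec_eq_iff by blast
  qed
qed

lemma real_bracket_torus:
  fixes z :: "complex ^ 'n::finite"
  assumes z: "z \<in> torus"
    and df: "\<And>v. frechet_derivative f (at z) v = Re (\<Sum>j\<in>UNIV. g j * (v $ j / z $ j))"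
    and df': "\<And>v. frechet_derivative f' (at z) v = Re (\<Sum>j\<in>UNIV. g' j * (v $ j / z $ j))"
  shows "real_bracket (torus_tangent z) f f' z = (\<Sum>j\<in>UNIV. Im (centred g j * cnj (centred g' j)))"
  unfolding real_bracket_def ham_vector_torus[OF z df] ham_vector_torus[OF z df']
    sympl_log_coordinates[OF torus_nonzero[OF z]]
  using torus_nonzero[OF z] by (simp add: algebra_simps flip: sum_negf)

section \<open>The Poisson bracket of polynomials\<close>

text \<open>The part of the bracket in which \<open>p\<close> is differentiated in the \<open>z\<^sub>j\<close> and \<open>q\<close> in their conjugates.
  The subtracted term comes from centring both gradients.  Each half is a derivation in either
  argument, which is why the two halves are treated separately.\<close>

definition half_bracket :: "'n::finite zpoly \<Rightarrow> 'n zpoly \<Rightarrow> 'n zpoly" where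
  "half_bracket p q = (\<Sum>j\<in>UNIV. euler (Inl j) p * euler (Inr j) q) -
    Const (1 / of_nat CARD('n)) * ((\<Sum>j\<in>UNIV. euler (Inl j) p) * (\<Sum>k\<in>UNIV. euler (Inr k) q))"

definition poly_bracket :: "'n::finite zpoly \<Rightarrow> 'n zpoly \<Rightarrow> 'n zpoly" where
  "poly_bracket p q = Const (- 2 * \<i>) * (half_bracket p q - half_bracket q p)"

lemma sum_centred_centred:
  "(\<Sum>j\<in>UNIV. centred g j * centred h j) =
    (\<Sum>j\<in>UNIV. g j * h j) - (\<Sum>j\<in>UNIV. g j) * (\<Sum>j\<in>UNIV. h j) / of_nat CARD('n)"
  for g h :: "'n::finite \<Rightarrow> complex"
proof -
  have "(\<Sum>j\<in>UNIV. centred g j * centred h j) = (\<Sum>j\<in>UNIV. g j * centred h j)"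
    by (rule sum_centred_mult) (rule sum_centred)
  also have "\<dots> = (\<Sum>j\<in>UNIV. g j * h j) - (\<Sum>j\<in>UNIV. g j) * ((\<Sum>j\<in>UNIV. h j) / of_nat CARD('n))"
    unfolding centred_def by (simp only: right_diff_distrib sum_subtractf sum_distrib_right)
  finally show ?thesis by simp
qed

text \<open>The gradients of the real and imaginary parts of \<open>p\<close> are combinations of \<open>P\<close> and \<open>Q\<close>, the
  holomorphic and antiholomorphic gradients of \<open>p\<close>; in the complex bilinear extension only the
  pairings of a \<open>P\<close> with a \<open>Q\<close> survive.\<close>

lemma fun_bracket_peval:
  fixes p q :: "'n::finite zpoly"
  assumes z: "z \<in> torus"
  shows "fun_bracket (torus_tangent z) (peval p) (peval q) z = peval (poly_bracket p q) z"
proof -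
  define P where "P p j = peval (euler (Inl j) p) z" for p and j :: 'n
  define Q where "Q p j = peval (euler (Inr j) p) z" for p and j :: 'n
  define gRe gIm where "gRe p j = P p j + cnj (Q p j)" and "gIm p j = - \<i> * (P p j - cnj (Q p j))"
    for p and j :: 'n
  note D = peval_has_derivative[OF torus_nonzero[OF z]]
  have dRe: "frechet_derivative (\<lambda>u. Re (peval p u)) (at z) v = Re (\<Sum>j\<in>UNIV. gRe p j * (v $ j / z $ j))"
    and dIm: "frechet_derivative (\<lambda>u. Im (peval p u)) (at z) v = Re (\<Sum>j\<in>UNIV. gIm p j * (v $ j / z $ j))"
    for p v
  proof -
    have "Re (P p j * a + Q p j * cnj a) = Re (gRe p j * a)" "Im (P p j * a + Q p j * cnj a) = Re (gIm p j * a)"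
      for j a by (simp_all add: gRe_def gIm_def algebra_simps)
    then have "Re (peval_deriv p z v) = Re (\<Sum>j\<in>UNIV. gRe p j * (v $ j / z $ j))"
      "Im (peval_deriv p z v) = Re (\<Sum>j\<in>UNIV. gIm p j * (v $ j / z $ j))"
      unfolding peval_deriv_def P_def Q_def by (simp_all only: Re_sum Im_sum)
    moreover have "frechet_derivative (\<lambda>u. Re (peval p u)) (at z) = (\<lambda>v. Re (peval_deriv p z v))"
      "frechet_derivative (\<lambda>u. Im (peval p u)) (at z) = (\<lambda>v. Im (peval_deriv p z v))"
      by (rule frechet_derivative_at[symmetric], intro has_derivative_Re has_derivative_Im D)+
    ultimately show "frechet_derivative (\<lambda>u. Re (peval p u)) (at z) v = Re (\<Sum>j\<in>UNIV. gRe p j * (v $ j / z $ j))"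
      "frechet_derivative (\<lambda>u. Im (peval p u)) (at z) v = Re (\<Sum>j\<in>UNIV. gIm p j * (v $ j / z $ j))"
      by simp_all
  qed
  have centred_gRe: "centred (gRe p) j = centred (P p) j + cnj (centred (Q p) j)"
    and centred_gIm: "centred (gIm p) j = - \<i> * (centred (P p) j - cnj (centred (Q p) j))" for p j
    unfolding centred_def gRe_def gIm_def
    by (simp_all add: sum.distrib sum_subtractf sum_distrib_left[symmetric] diff_divide_distrib
        add_divide_distrib algebra_simps)
  note brackets = real_bracket_torus[OF z dRe dRe] real_bracket_torus[OF z dIm dIm]
    real_bracket_torus[OF z dRe dIm] real_bracket_torus[OF z dIm dRe]
  have "fun_bracket (torus_tangent z) (peval p) (peval q) z =
      (\<Sum>j\<in>UNIV. - 2 * \<i> * (centred (P p) j * centred (Q q) j - centred (P q) j * centred (Q p) j))"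
    unfolding fun_bracket_def brackets centred_gRe centred_gIm
    by (simp add: complex_eq_iff Re_sum Im_sum algebra_simps flip: sum.distrib sum_subtractf)
  also have "\<dots> = - 2 * \<i> * ((\<Sum>j\<in>UNIV. centred (P p) j * centred (Q q) j) - (\<Sum>j\<in>UNIV. centred (P q) j * centred (Q p) j))"
    by (simp only: sum_distrib_left[symmetric] sum_subtractf)
  also have "\<dots> = peval (poly_bracket p q) z"
    unfolding sum_centred_centred poly_bracket_def half_bracket_def P_def Q_def peval_simps
    by (simp add: sum_subtractf field_simps)
  finally show ?thesis .
qed

lemma half_bracket_add_left: "half_bracket (p + p') q = half_bracket p q + half_bracket p' q"
  by (simp add: half_bracket_def euler_add sum.distrib distrib_right distrib_left)

lemma half_bracket_add_right: "half_bracket q (p + p') = half_bracket q p + half_bracket q p'"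
  by (simp add: half_bracket_def euler_add sum.distrib distrib_right distrib_left)

lemma half_bracket_mult_left: "half_bracket (r * p) q = r * half_bracket p q + p * half_bracket r q"
proof -
  have "(\<Sum>j\<in>UNIV. euler (Inl j) (r * p) * euler (Inr j) q) =
      r * (\<Sum>j\<in>UNIV. euler (Inl j) p * euler (Inr j) q) + p * (\<Sum>j\<in>UNIV. euler (Inl j) r * euler (Inr j) q)"
    by (simp add: euler_mult algebra_simps sum.distrib sum_distrib_left)
  moreover have "(\<Sum>j\<in>UNIV. euler (Inl j) (r * p)) = r * (\<Sum>j\<in>UNIV. euler (Inl j) p) + p * (\<Sum>j\<in>UNIV. euler (Inl j) r)"
    by (simp add: euler_mult algebra_simps sum.distrib sum_distrib_left)
  ultimately show ?thesis
    by (simp add: half_bracket_def algebra_simps)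
qed

lemma half_bracket_mult_right: "half_bracket q (r * p) = r * half_bracket q p + p * half_bracket q r"
proof -
  have "(\<Sum>j\<in>UNIV. euler (Inl j) q * euler (Inr j) (r * p)) =
      r * (\<Sum>j\<in>UNIV. euler (Inl j) q * euler (Inr j) p) + p * (\<Sum>j\<in>UNIV. euler (Inl j) q * euler (Inr j) r)"
    by (simp add: euler_mult algebra_simps sum.distrib sum_distrib_left)
  moreover have "(\<Sum>j\<in>UNIV. euler (Inr j) (r * p)) = r * (\<Sum>j\<in>UNIV. euler (Inr j) p) + p * (\<Sum>j\<in>UNIV. euler (Inr j) r)"
    by (simp add: euler_mult algebra_simps sum.distrib sum_distrib_left)
  ultimately show ?thesis
    by (simp add: half_bracket_def algebra_simps)
qed

lemma poly_bracket_add_left: "poly_bracket (p + p') q = poly_bracket p q + poly_bracket p' q"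
  by (simp add: poly_bracket_def half_bracket_add_left half_bracket_add_right algebra_simps)

lemma poly_bracket_add_right: "poly_bracket q (p + p') = poly_bracket q p + poly_bracket q p'"
  by (simp add: poly_bracket_def half_bracket_add_left half_bracket_add_right algebra_simps)

lemma poly_bracket_mult_left: "poly_bracket (r * p) q = r * poly_bracket p q + p * poly_bracket r q"
  by (simp add: poly_bracket_def half_bracket_mult_left half_bracket_mult_right algebra_simps)

lemma poly_bracket_antisym: "poly_bracket q p = - poly_bracket p q"
  by (simp add: poly_bracket_def algebra_simps)

lemma euler_prod_Var:
  assumes "finite A" "inj g"
  shows "euler v (\<Prod>i\<in>A. Var (g i)) = (if v \<in> g ` A then \<Prod>i\<in>A. Var (g i) else 0)"
  using assms(1)
proof (induction A)
  case empty
  show ?case using euler_Const[of v 1] by (simp add: Const_one)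
next
  case (insert a A)
  then have "g a \<notin> g ` A" using assms by (auto dest: injD)
  then show ?case
    using insert by (auto simp: euler_mult euler_Var)
qed

text \<open>The functions that cut out the torus are Casimir functions: all \<open>E\<^sub>j \<sigma>\<^sub>n\<close> equal \<open>\<sigma>\<^sub>n\<close>, and a constant
  vector is annihilated by centring.\<close>

lemma half_bracket_elem_sym_card:
  fixes q :: "'n::finite zpoly"
  shows "half_bracket (elem_sym CARD('n) - 1) q = 0" "half_bracket q (elem_sym CARD('n) - 1) = 0"
    "half_bracket (elem_sym_bar CARD('n) - 1) q = 0" "half_bracket q (elem_sym_bar CARD('n) - 1) = 0"
proof -
  have diff: "euler v (p - 1) = euler v p" for v and p :: "'n zpoly"
    using euler_add[of v p "Const (- 1)"] by (simp add: euler_Const) (simp add: Const_def single_uminus)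
  have e: "euler (Inl j) (elem_sym CARD('n)) = elem_sym CARD('n)" "euler (Inr j) (elem_sym CARD('n)) = 0"
    "euler (Inr j) (elem_sym_bar CARD('n)) = elem_sym_bar CARD('n)" "euler (Inl j) (elem_sym_bar CARD('n)) = 0"
    for j :: 'n
    unfolding elem_sym_card elem_sym_bar_card by (auto simp: euler_prod_Var)
  let ?c = "Const (1 / of_nat CARD('n)) :: 'n zpoly"
  have unit: "?c * of_nat CARD('n) = 1"
    by (simp flip: Const_of_nat Const_mult Const_one)
  have scale: "?c * (of_nat CARD('n) * p * r) = p * r" "?c * (p * (of_nat CARD('n) * r)) = p * r" for p r
  proof -
    have "?c * (of_nat CARD('n) * p * r) = ?c * of_nat CARD('n) * (p * r)"
      "?c * (p * (of_nat CARD('n) * r)) = ?c * of_nat CARD('n) * (p * r)"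
      by (simp_all only: mult_ac)
    then show "?c * (of_nat CARD('n) * p * r) = p * r" "?c * (p * (of_nat CARD('n) * r)) = p * r"
      by (simp_all only: unit mult_1_left)
  qed
  show "half_bracket (elem_sym CARD('n) - 1) q = 0" "half_bracket q (elem_sym CARD('n) - 1) = 0"
    "half_bracket (elem_sym_bar CARD('n) - 1) q = 0" "half_bracket q (elem_sym_bar CARD('n) - 1) = 0"
    by (simp_all add: half_bracket_def diff e scale flip: sum_distrib_left sum_distrib_right)
qed

text \<open>By the Leibniz rule the bracket with a multiple of \<open>p\<close> involves \<open>p\<close> itself, so membership of \<open>p\<close>
  has to be carried along the induction.\<close>

lemma poly_bracket_torus_ideal_left: "p \<in> torus_ideal \<Longrightarrow> poly_bracket p q \<in> torus_ideal"
proof -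
  assume p: "p \<in> torus_ideal"
  have "p \<in> torus_ideal \<and> poly_bracket p q \<in> torus_ideal"
    using p
  proof (induction p rule: torus_ideal_induct)
    case (add p r)
    then show ?case by (simp add: poly_bracket_add_left torus_ideal_add)
  next
    case (mult p r)
    then have "r * poly_bracket p q \<in> torus_ideal" "poly_bracket r q * p \<in> torus_ideal" "r * p \<in> torus_ideal"
      by (auto intro: torus_ideal_mult)
    then show ?case
      by (simp add: poly_bracket_mult_left torus_ideal_add mult.commute[of p "poly_bracket r q"])
  qed (simp_all add: elem_sym_minus_1_in_torus_ideal poly_bracket_def half_bracket_elem_sym_card
      torus_ideal_zero)
  then show ?thesis by simp
qed

lemma poly_bracket_torus_ideal_right: "p \<in> torus_ideal \<Longrightarrow> poly_bracket q p \<in> torus_ideal"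
  using torus_ideal_mult[OF poly_bracket_torus_ideal_left, of p "- 1" q]
  by (simp add: poly_bracket_antisym[of q p])

lemma poly_bracket_cong:
  assumes p: "p' - p \<in> torus_ideal" and q: "q' - q \<in> torus_ideal"
  shows "poly_bracket p' q' - poly_bracket p q \<in> torus_ideal"
proof -
  have "poly_bracket p' q' = poly_bracket p q' + poly_bracket (p' - p) q'"
    by (simp flip: poly_bracket_add_left)
  moreover have "poly_bracket p q' = poly_bracket p q + poly_bracket p (q' - q)"
    by (simp flip: poly_bracket_add_right)
  ultimately show ?thesis
    using torus_ideal_add[OF poly_bracket_torus_ideal_left[OF p] poly_bracket_torus_ideal_right[OF q], of q' p]
    by (simp add: algebra_simps)
qed

section \<open>Invariant polynomials\<close>

definition symmetric :: "'n::finite zpoly \<Rightarrow> bool" where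
  "symmetric p \<longleftrightarrow> (\<forall>\<pi>. bij \<pi> \<longrightarrow> perm_act \<pi> p = p)"

lemma symmetric_add: "symmetric p \<Longrightarrow> symmetric q \<Longrightarrow> symmetric (p + q)"
  and symmetric_mult: "symmetric p \<Longrightarrow> symmetric q \<Longrightarrow> symmetric (p * q)"
  and symmetric_Const: "symmetric (Const c)"
  and symmetric_one: "symmetric 1"
  by (simp_all add: symmetric_def perm_act_simps)

lemma perm_act_half_bracket:
  assumes "bij \<pi>"
  shows "perm_act \<pi> (half_bracket p q) = half_bracket (perm_act \<pi> p) (perm_act \<pi> q)"
proof -
  have reindex: "(\<Sum>j\<in>UNIV. f (\<pi> j)) = sum f UNIV" for f :: "'a \<Rightarrow> 'a zpoly"
    using sum.reindex_bij_betw[of \<pi> UNIV UNIV f] assms by simp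
  let ?p = "perm_act \<pi> p" and ?q = "perm_act \<pi> q"
  show ?thesis
    using assms reindex[of "\<lambda>j. euler (Inl j) ?p * euler (Inr j) ?q"]
      reindex[of "\<lambda>j. euler (Inl j) ?p"] reindex[of "\<lambda>j. euler (Inr j) ?q"]
    by (simp add: half_bracket_def perm_act_simps perm_act_euler)
qed

lemma symmetric_poly_bracket: "symmetric p \<Longrightarrow> symmetric q \<Longrightarrow> symmetric (poly_bracket p q)"
  by (simp add: symmetric_def poly_bracket_def perm_act_simps perm_act_half_bracket)

lemma symmetric_power_sum: "symmetric (power_sum k :: 'n::finite zpoly)"
  and symmetric_power_sum_bar: "symmetric (power_sum_bar k :: 'n zpoly)"
proof -
  have "(\<Sum>j\<in>UNIV. f (\<pi> j)) = sum f UNIV" if "bij \<pi>" for \<pi> :: "'n \<Rightarrow> 'n" and f :: "'n \<Rightarrow> 'n zpoly"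
    using sum.reindex_bij_betw[of \<pi> UNIV UNIV f] that by simp
  from this[of _ "\<lambda>j. Var (Inl j) ^ k"] this[of _ "\<lambda>j. Var (Inr j) ^ k"]
  show "symmetric (power_sum k :: 'n zpoly)" "symmetric (power_sum_bar k :: 'n zpoly)"
    by (simp_all add: symmetric_def power_sum_def power_sum_bar_def perm_act_simps)
qed

lemma symmetric_elem_sym: "symmetric (elem_sym k :: 'n::finite zpoly)"
  and symmetric_elem_sym_bar: "symmetric (elem_sym_bar k :: 'n zpoly)"
proof -
  have *: "(\<Sum>S | card S = k. \<Prod>j\<in>S. f (\<pi> j)) = (\<Sum>S | card S = k. \<Prod>j\<in>S. f j)"
    if "bij \<pi>" for \<pi> :: "'n \<Rightarrow> 'n" and f :: "'n \<Rightarrow> 'n zpoly"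
  proof -
    have inj: "inj_on \<pi> S" for S using that by (meson bij_is_inj inj_on_subset subset_UNIV)
    have "(\<Sum>S | card S = k. \<Prod>j\<in>S. f (\<pi> j)) = (\<Sum>S | card S = k. \<Prod>j\<in>\<pi> ` S. f j)"
      by (simp add: prod.reindex[OF inj])
    also have "\<dots> = (\<Sum>S | card S = k. \<Prod>j\<in>S. f j)"
      using that inj
      by (intro sum.reindex_bij_witness[where i = "\<lambda>S. inv_into UNIV \<pi> ` S" and j = "\<lambda>S. \<pi> ` S"])
        (auto simp: card_image image_comp bij_is_inj surj_f_inv_f[OF bij_is_surj]
          card_image[OF inj_on_subset[OF bij_is_inj[OF bij_imp_bij_inv]]])
    finally show ?thesis .
  qed
  from *[of _ "\<lambda>j. Var (Inl j)"] *[of _ "\<lambda>j. Var (Inr j)"]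
  show "symmetric (elem_sym k :: 'n zpoly)" "symmetric (elem_sym_bar k :: 'n zpoly)"
    by (simp_all add: symmetric_def elem_sym_def elem_sym_bar_def perm_act_simps)
qed

section \<open>The coordinate ring of the adjoint quotient\<close>

lemma mem_cls: "q \<in> cls p \<longleftrightarrow> q - p \<in> torus_ideal"
proof -
  have "cls p = {h + p | h. h \<in> torus_ideal}"
    by (auto simp: cls_def a_r_coset_def r_coset_def ring_of_type_algebra_simps)
  then show ?thesis by (auto intro!: exI[of _ "q - p"])
qed

lemma cls_eq_iff: "cls p = cls q \<longleftrightarrow> p - q \<in> torus_ideal"
proof
  assume "cls p = cls q"
  moreover have "p \<in> cls p" by (simp add: mem_cls torus_ideal_zero)
  ultimately show "p - q \<in> torus_ideal" using mem_cls by metis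
next
  assume pq: "p - q \<in> torus_ideal"
  have "r - p \<in> torus_ideal \<longleftrightarrow> r - q \<in> torus_ideal" for r
    using torus_ideal_add[OF _ pq, of "r - p"] torus_ideal_diff[OF _ pq, of "r - q"] by auto
  then show "cls p = cls q" by (auto simp: mem_cls)
qed

lemma torus_ring_cls:
  "carrier torus_ring = range cls"
  "mult torus_ring (cls p) (cls q) = cls (p * q)" "add torus_ring (cls p) (cls q) = cls (p + q)"
  "one torus_ring = cls 1"
proof -
  note hom = ideal.rcos_ring_hom[OF ideal_torus_ideal, folded torus_ring_def]
  show "carrier torus_ring = range cls"
    by (auto simp: torus_ring_def FactRing_def A_RCOSETS_defs cls_def a_r_coset_def ring_of_type_algebra_simps)
  show "mult torus_ring (cls p) (cls q) = cls (p * q)" "add torus_ring (cls p) (cls q) = cls (p + q)"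
    using ring_hom_mult[OF hom, of p q] ring_hom_add[OF hom, of p q]
    by (simp_all add: cls_def ring_of_type_algebra_simps)
  show "one torus_ring = cls 1"
    using ring_hom_one[OF hom, symmetric] by (simp add: cls_def ring_of_type_algebra_simps)
qed

text \<open>Existence of the class in the definite description is \<open>fun_bracket_peval\<close> together with the
  compatibility of the bracket with the ideal; its uniqueness is that only the ideal vanishes on
  the torus.\<close>

lemma torus_bracket_cls: "torus_bracket (cls p) (cls q) = cls (poly_bracket p q)"
  unfolding torus_bracket_def
proof (rule the_equality)
  have eval: "peval r z = fun_bracket (torus_tangent z) (peval p') (peval q') z"
    if "p' \<in> cls p" "q' \<in> cls q" "r \<in> cls (poly_bracket p q)" "z \<in> torus" for p' q' r z
  proof -
    have "r - poly_bracket p' q' \<in> torus_ideal"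
      using torus_ideal_diff[OF _ poly_bracket_cong, of "r - poly_bracket p q" p' p q' q] that
      by (simp add: mem_cls)
    then have "peval (r - poly_bracket p' q') z = 0"
      using that(4) by (rule peval_torus_ideal)
    then show ?thesis
      using that(4) by (simp add: fun_bracket_peval peval_simps)
  qed
  then show "cls (poly_bracket p q) \<in> carrier torus_ring \<and> (\<forall>p'\<in>cls p. \<forall>q'\<in>cls q.
      \<forall>r\<in>cls (poly_bracket p q). \<forall>z\<in>torus. peval r z = fun_bracket (torus_tangent z) (peval p') (peval q') z)"
    by (auto simp: torus_ring_cls)
  fix c
  assume c: "c \<in> carrier torus_ring \<and> (\<forall>p'\<in>cls p. \<forall>q'\<in>cls q. \<forall>r\<in>c. \<forall>z\<in>torus.
      peval r z = fun_bracket (torus_tangent z) (peval p') (peval q') z)"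
  then obtain r where r: "c = cls r" by (auto simp: torus_ring_cls)
  have self: "p \<in> cls p" for p :: "'a zpoly" by (simp add: mem_cls torus_ideal_zero)
  have "peval (r - poly_bracket p q) z = 0" if "z \<in> torus" for z
    using c that self[of p] self[of q] self[of r] unfolding r
    by (simp add: fun_bracket_peval[OF that] peval_simps)
  then show "c = cls (poly_bracket p q)"
    unfolding r cls_eq_iff by (rule vanishing_on_torus_imp_torus_ideal)
qed

lemma perm_act_torus_ideal:
  fixes p :: "'n::finite zpoly"
  assumes "bij \<pi>" "p \<in> torus_ideal"
  shows "perm_act \<pi> p \<in> torus_ideal"
  using assms(2)
proof (induction p rule: torus_ideal_induct)
  case elem_sym
  have "perm_act \<pi> (elem_sym CARD('n)) = elem_sym CARD('n)"
    using symmetric_elem_sym[where 'n = 'n] assms(1) by (simp add: symmetric_def)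
  then show ?case
    by (simp add: perm_act_simps elem_sym_minus_1_in_torus_ideal)
next
  case elem_sym_bar
  have "perm_act \<pi> (elem_sym_bar CARD('n)) = elem_sym_bar CARD('n)"
    using symmetric_elem_sym_bar[where 'n = 'n] assms(1) by (simp add: symmetric_def)
  then show ?case
    by (simp add: perm_act_simps elem_sym_minus_1_in_torus_ideal)
qed (simp_all add: perm_act_simps torus_ideal_add torus_ideal_mult)

lemma perm_act_image_cls:
  assumes "bij \<pi>" "symmetric p"
  shows "perm_act \<pi> ` cls p = cls p"
proof -
  have sub: "perm_act \<rho> q \<in> cls p" if "bij \<rho>" "q \<in> cls p" for \<rho> q
    using perm_act_torus_ideal[of \<rho> "q - p"] that assms(2)
    by (simp add: mem_cls perm_act_simps symmetric_def)
  have "q \<in> perm_act \<pi> ` cls p" if "q \<in> cls p" for q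
  proof
    show "perm_act (inv_into UNIV \<pi>) q \<in> cls p" using assms that by (simp add: sub bij_imp_bij_inv)
    have "\<pi> \<circ> inv_into UNIV \<pi> = id" using assms(1) by (simp add: bij_is_surj flip: surj_iff)
    then show "q = perm_act \<pi> (perm_act (inv_into UNIV \<pi>) q)" by (simp add: perm_act_comp perm_act_id)
  qed
  then show ?thesis using sub assms(1) by auto
qed

text \<open>The representative is the average of the translates of \<open>p\<close>, each of which is congruent to
  \<open>p\<close>.\<close>

lemma invariant_cls_has_symmetric_representative:
  assumes inv: "\<And>\<pi>. bij \<pi> \<Longrightarrow> perm_act \<pi> ` cls p = cls p"
  obtains q :: "'n::finite zpoly" where "symmetric q" "cls q = cls p"
proof -
  define B where "B = {\<pi> :: 'n \<Rightarrow> 'n. bij \<pi>}"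
  have B: "finite B" "card B \<noteq> 0"
    using bij_id by (auto simp: B_def card_eq_0_iff)
  define q where "q = Const (1 / of_nat (card B)) * (\<Sum>\<pi>\<in>B. perm_act \<pi> p)"
  have "perm_act \<rho> q = q" if \<rho>: "bij \<rho>" for \<rho>
  proof -
    have "(\<Sum>\<pi>\<in>B. perm_act (\<rho> \<circ> \<pi>) p) = (\<Sum>\<pi>\<in>B. perm_act \<pi> p)"
      by (rule sum.reindex_bij_witness[where i = "\<lambda>\<pi>. inv_into UNIV \<rho> \<circ> \<pi>" and j = "\<lambda>\<pi>. \<rho> \<circ> \<pi>"])
        (use \<rho> in \<open>auto simp: B_def bij_comp bij_imp_bij_inv bij_is_inj bij_is_surj surj_f_inv_f fun_eq_iff\<close>)
    then show ?thesis
      by (simp add: q_def perm_act_simps perm_act_comp)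
  qed
  then have "symmetric q" by (simp add: symmetric_def)
  have "Const (1 / of_nat (card B)) * of_nat (card B) = (1 :: 'n zpoly)"
    using B(2) by (simp flip: Const_of_nat Const_mult Const_one)
  then have "Const (1 / of_nat (card B)) * (\<Sum>\<pi>\<in>B. p) = p"
    by (simp flip: mult.assoc)
  then have "q - p = Const (1 / of_nat (card B)) * (\<Sum>\<pi>\<in>B. perm_act \<pi> p - p)"
    by (simp add: q_def sum_subtractf right_diff_distrib)
  moreover have "perm_act \<pi> p - p \<in> torus_ideal" if "bij \<pi>" for \<pi>
    using inv[OF that] mem_cls[of p p] by (auto simp: torus_ideal_zero simp flip: mem_cls)
  ultimately have "q - p \<in> torus_ideal"
    by (auto simp only: B_def mem_Collect_eq intro!: torus_ideal_mult torus_ideal_sum)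
  with \<open>symmetric q\<close> show ?thesis by (intro that) (simp_all add: cls_eq_iff)
qed

lemma carrier_adjoint_quotient:
  "carrier (adjoint_quotient :: (complex, 'n::finite zpoly set) poisson_algebra) = cls ` {p. symmetric p}"
proof
  show "carrier (adjoint_quotient :: (complex, 'n zpoly set) poisson_algebra) \<subseteq> cls ` {p. symmetric p}"
  proof
    fix a :: "'n zpoly set"
    assume "a \<in> carrier adjoint_quotient"
    then obtain p where p: "a = cls p" "\<And>\<pi>. bij \<pi> \<Longrightarrow> perm_act \<pi> ` cls p = cls p"
      by (auto simp: adjoint_quotient_def torus_ring_cls)
    obtain q where "symmetric q" "cls q = cls p"
      by (rule invariant_cls_has_symmetric_representative[OF p(2)])
    then show "a \<in> cls ` {p. symmetric p}" using p(1) by auto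
  qed
  show "cls ` {p. symmetric p} \<subseteq> carrier (adjoint_quotient :: (complex, 'n zpoly set) poisson_algebra)"
    using perm_act_image_cls by (auto simp: adjoint_quotient_def torus_ring_cls simp del: image_iff)
qed

lemma adjoint_quotient_cls:
  "mult adjoint_quotient (cls p) (cls q) = cls (p * q)"
  "add adjoint_quotient (cls p) (cls q) = cls (p + q)"
  "one adjoint_quotient = cls 1"
  "smult adjoint_quotient c (cls p) = cls (Const c * p)"
  "pbracket adjoint_quotient (cls p) (cls q) = cls (poly_bracket p q)"
  by (simp_all add: adjoint_quotient_def torus_ring_cls torus_bracket_cls)

section \<open>Generation\<close>

definition bipower_sum :: "nat \<Rightarrow> nat \<Rightarrow> 'n::finite zpoly" where
  "bipower_sum k l = (\<Sum>j\<in>UNIV. Var (Inl j) ^ k * Var (Inr j) ^ l)"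

locale zpoly_subalgebra =
  fixes U :: "'n::finite zpoly set"
  assumes Const_mem: "Const c \<in> U"
    and add_mem: "p \<in> U \<Longrightarrow> q \<in> U \<Longrightarrow> p + q \<in> U"
    and mult_mem: "p \<in> U \<Longrightarrow> q \<in> U \<Longrightarrow> p * q \<in> U"
begin

lemma one_mem: "1 \<in> U"
  using Const_mem[of 1] by (simp add: Const_one)

lemma of_nat_mem: "of_nat k \<in> U"
  using Const_mem[of "of_nat k"] by (simp add: Const_of_nat)

lemma zero_mem: "0 \<in> U"
  using of_nat_mem[of 0] by simp

lemma uminus_mem: "p \<in> U \<Longrightarrow> - p \<in> U"
  using mult_mem[OF Const_mem[of "- 1"], of p] by (simp add: Const_def single_uminus)

lemma diff_mem: "p \<in> U \<Longrightarrow> q \<in> U \<Longrightarrow> p - q \<in> U"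
  using add_mem[OF _ uminus_mem, of p q] by simp

lemma power_mem: "p \<in> U \<Longrightarrow> p ^ k \<in> U"
  by (induction k) (simp_all add: one_mem mult_mem)

lemma sum_mem: "(\<And>a. a \<in> A \<Longrightarrow> f a \<in> U) \<Longrightarrow> sum f A \<in> U"
  by (induction A rule: infinite_finite_induct) (simp_all add: zero_mem add_mem)

lemma of_nat_mult_memD:
  assumes "of_nat k * p \<in> U" "k > 0"
  shows "p \<in> U"
proof -
  have "Const (1 / of_nat k) * of_nat k = (1 :: 'n zpoly)"
    using assms(2) by (simp flip: Const_of_nat Const_mult Const_one)
  then have "Const (1 / of_nat k) * (of_nat k * p) = p"
    by (simp flip: mult.assoc)
  then show ?thesis using mult_mem[OF Const_mem assms(1)] by metis
qed

text \<open>Newton's identity expresses \<open>k\<close> times the \<open>k\<close>-th elementary symmetric function through lower ones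
  and power sums; beyond \<open>n\<close> these functions are \<open>0\<close>.  Here \<open>x\<close> stands for the \<open>z\<^sub>j\<close> or for
  their conjugates.\<close>

lemma elementary_mem_of_power_sums:
  assumes "\<And>k. 1 \<le> k \<Longrightarrow> k \<le> CARD('n) \<Longrightarrow> (\<Sum>j\<in>UNIV. x j ^ k) \<in> U"
  shows "(\<Sum>S | card S = k. \<Prod>j\<in>(S :: 'n set). x j) \<in> U"
proof (induction k rule: less_induct)
  case (less k)
  show ?case
  proof (cases k)
    case 0
    have "{S :: 'n set. card S = 0} = {{}}" by auto
    then show ?thesis using 0 one_mem by simp
  next
    case (Suc m)
    show ?thesis
    proof (cases "k \<le> CARD('n)")
      case True
      have "(-1) ^ i * (\<Sum>j\<in>UNIV. x j ^ Suc i) * (\<Sum>S | card S = m - i. \<Prod>j\<in>(S :: 'n set). x j) \<in> U"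
        if "i \<le> m" for i
        using that Suc True by (intro mult_mem power_mem uminus_mem one_mem assms less.IH) auto
      then have "of_nat (Suc m) * (\<Sum>S | card S = Suc m. \<Prod>j\<in>(S :: 'n set). x j) \<in> U"
        using newton_identity[of "UNIV :: 'n set" m x]
        by (simp only: subset_UNIV simp_thms finite) (rule sum_mem, simp)
      then show ?thesis
        unfolding Suc by (rule of_nat_mult_memD) simp
    next
      case False
      have "card S \<le> CARD('n)" for S :: "'n set" by (rule card_mono) auto
      then have "{S :: 'n set. card S = k} = {}" using False by auto
      then show ?thesis by (simp only: sum.empty zero_mem)
    qed
  qed
qed

lemma power_sum_mem_of_elementary:
  assumes e: "\<And>k. (\<Sum>S | card S = k. \<Prod>j\<in>(S :: 'n set). x j) \<in> U"
  shows "(\<Sum>j\<in>UNIV. x j ^ k) \<in> U"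
proof (induction k rule: less_induct)
  case (less k)
  let ?e = "\<lambda>k. \<Sum>S | card S = k. \<Prod>j\<in>(S :: 'n set). x j" and ?p = "\<lambda>k. \<Sum>j\<in>UNIV. x j ^ k"
  show ?case
  proof (cases k)
    case 0
    then show ?thesis using of_nat_mem by simp
  next
    case (Suc m)
    have e0: "?e 0 = 1"
    proof -
      have "{S :: 'n set. card S = 0} = {{}}" by auto
      then show ?thesis by simp
    qed
    have "of_nat (Suc m) * ?e (Suc m) = (\<Sum>i<m. (-1) ^ i * ?p (Suc i) * ?e (m - i)) + (-1) ^ m * ?p (Suc m)"
      using newton_identity[of "UNIV :: 'n set" m x]
      by (simp only: lessThan_Suc_atMost[symmetric] sum.lessThan_Suc subset_UNIV simp_thms diff_self_eq_0 e0 finite_UNIV finite mult_1_right)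
    then have "(-1) ^ m * ?p (Suc m) = of_nat (Suc m) * ?e (Suc m) - (\<Sum>i<m. (-1) ^ i * ?p (Suc i) * ?e (m - i))"
      by (simp only: add_diff_cancel_left')
    also have "\<dots> \<in> U"
    proof -
      have "(-1) ^ i * ?p (Suc i) * ?e (m - i) \<in> U" if "i < m" for i
        using that Suc by (intro mult_mem e power_mem uminus_mem one_mem less.IH) auto
      then have "(\<Sum>i<m. (-1) ^ i * ?p (Suc i) * ?e (m - i)) \<in> U"
        by (intro sum_mem) simp
      then show ?thesis
        by (intro diff_mem mult_mem of_nat_mem e)
    qed
    finally have "(-1) ^ m * ((-1) ^ m * ?p (Suc m)) \<in> U"
      by (rule mult_mem[OF power_mem[OF uminus_mem[OF one_mem]]])
    then show ?thesis
      unfolding Suc left_minus_one_mult_self .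
  qed
qed

text \<open>Weyl's theorem: up to the factor \<open>n!\<close> an invariant polynomial is the sum of its translates, hence
  a sum of orbit sums of monomials, and these are sums over the injections of the whole index set.\<close>

lemma symmetric_mem_of_bipower_sums:
  assumes bipower: "\<And>k l. bipower_sum k l \<in> U" and p: "symmetric p"
  shows "p \<in> U"
proof -
  define B where "B = {\<pi> :: 'n \<Rightarrow> 'n. bij \<pi>}"
  have B: "finite B" "card B > 0"
    using bij_id by (auto simp: B_def card_gt_0_iff)
  have inj: "injections (UNIV :: 'n set) = B"
    by (auto simp: injections_def B_def bij_def finite_UNIV_inj_surj)
  define u :: "nat \<times> nat \<Rightarrow> 'n \<Rightarrow> 'n zpoly" where "u e j = Var (Inl j) ^ fst e * Var (Inr j) ^ snd e" for e j
  have orbit: "(\<Sum>\<pi>\<in>B. perm_act \<pi> (Poly_Mapping.single m c)) \<in> U" for m c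
  proof -
    define e where "e j = (Poly_Mapping.lookup m (Inl j), Poly_Mapping.lookup m (Inr j))" for j
    have "(\<Sum>\<pi>\<in>injections UNIV. \<Prod>j\<in>UNIV. u (e j) (\<pi> j)) \<in> U"
    proof (rule injection_sum_in_subring)
      show "(\<Sum>i\<in>UNIV. u e i) \<in> U" for e
        using bipower[of "fst e" "snd e"] by (simp add: bipower_sum_def u_def)
    qed (auto simp: u_def power_add mult_ac one_mem diff_mem mult_mem)
    then have "Const c * (\<Sum>\<pi>\<in>B. \<Prod>j\<in>UNIV. u (e j) (\<pi> j)) \<in> U"
      unfolding inj by (rule mult_mem[OF Const_mem])
    also have "Const c * (\<Sum>\<pi>\<in>B. \<Prod>j\<in>UNIV. u (e j) (\<pi> j)) = (\<Sum>\<pi>\<in>B. perm_act \<pi> (Poly_Mapping.single m c))"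
      by (simp add: sum_distrib_left perm_act_def substitute.psubst_single prod_UNIV_sum u_def e_def prod.distrib)
    finally show ?thesis .
  qed
  have "of_nat (card B) * p = (\<Sum>\<pi>\<in>B. perm_act \<pi> p)"
    using p by (simp add: B_def symmetric_def)
  also have "\<dots> = (\<Sum>\<pi>\<in>B. perm_act \<pi> (\<Sum>m\<in>Poly_Mapping.keys p. Poly_Mapping.single m (Poly_Mapping.lookup p m)))"
    by (simp only: sum_monomials[symmetric])
  also have "\<dots> = (\<Sum>m\<in>Poly_Mapping.keys p. \<Sum>\<pi>\<in>B. perm_act \<pi> (Poly_Mapping.single m (Poly_Mapping.lookup p m)))"
    unfolding perm_act_simps by (rule sum.swap)
  also have "\<dots> \<in> U"
    by (intro sum_mem orbit)
  finally show ?thesis using B(2) by (rule of_nat_mult_memD)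
qed

end

lemma poly_bracket_power_sums:
  "poly_bracket (power_sum k) (power_sum_bar l :: 'n::finite zpoly) = Const (- 2 * \<i>) * (of_nat k * of_nat l *
    (bipower_sum k l - Const (1 / of_nat CARD('n)) * (power_sum k * power_sum_bar l)))"
proof -
  have power: "of_nat k * Var v ^ (k - 1) * euler w (Var v) = (if w = v then of_nat k * Var v ^ k else 0)"
    for k and v w :: "'n + 'n"
    by (cases k) (simp_all add: euler_Var mult_ac)
  have e: "euler (Inl j) (power_sum k) = of_nat k * Var (Inl j) ^ k" "euler (Inr j) (power_sum k) = 0"
    "euler (Inr j) (power_sum_bar k) = of_nat k * Var (Inr j) ^ k" "euler (Inl j) (power_sum_bar k) = 0"
    for j :: 'n and k
    unfolding power_sum_def power_sum_bar_def euler_sum euler_power power by simp_all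
  have "half_bracket (power_sum k) (power_sum_bar l) = of_nat k * of_nat l *
      (bipower_sum k l - Const (1 / of_nat CARD('n)) * (power_sum k * power_sum_bar l :: 'n zpoly))"
  proof -
    have "(\<Sum>j\<in>UNIV. euler (Inl j) (power_sum k) * euler (Inr j) (power_sum_bar l)) =
        of_nat k * of_nat l * (bipower_sum k l :: 'n zpoly)"
      unfolding e bipower_sum_def by (simp add: sum_distrib_left mult_ac)
    moreover have "(\<Sum>j\<in>UNIV. euler (Inl j) (power_sum k)) = of_nat k * (power_sum k :: 'n zpoly)"
      "(\<Sum>j\<in>UNIV. euler (Inr j) (power_sum_bar l)) = of_nat l * (power_sum_bar l :: 'n zpoly)"
      unfolding e sum_distrib_left[symmetric] by (simp_all only: power_sum_def power_sum_bar_def)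
    ultimately show ?thesis
      unfolding half_bracket_def by (simp add: algebra_simps)
  qed
  moreover have "half_bracket (power_sum_bar l) (power_sum k :: 'n zpoly) = 0"
    by (simp add: half_bracket_def e)
  ultimately show ?thesis by (simp add: poly_bracket_def)
qed

lemma symmetric_mem_of_power_sums:
  fixes U :: "'n::finite zpoly set"
  assumes "zpoly_subalgebra U"
    and bracket: "\<And>p q. p \<in> U \<Longrightarrow> q \<in> U \<Longrightarrow> poly_bracket p q \<in> U"
    and power_sums: "\<And>k. power_sum k \<in> U" "\<And>k. power_sum_bar k \<in> U"
    and "symmetric p"
  shows "p \<in> U"
proof -
  interpret zpoly_subalgebra U by fact
  have "bipower_sum k l \<in> U" for k l
  proof (cases "k = 0 \<or> l = 0")
    case True
    then show ?thesis
      using power_sums[of k] power_sums[of l] by (auto simp: bipower_sum_def power_sum_def power_sum_bar_def)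
  next
    case False
    define c where "c = - 2 * \<i> * of_nat (k * l)"
    have c: "Const (1 / c) * Const c = (1 :: 'n zpoly)"
      using False by (simp add: c_def Const_one flip: Const_mult)
    let ?r = "Const (1 / of_nat CARD('n)) * (power_sum k * power_sum_bar l) :: 'n zpoly"
    have "Const c = Const (- 2 * \<i>) * (of_nat k * of_nat l :: 'n zpoly)"
      by (simp only: c_def Const_mult Const_of_nat of_nat_mult)
    then have bracket_eq: "poly_bracket (power_sum k) (power_sum_bar l) = Const c * (bipower_sum k l - ?r)"
      by (simp only: poly_bracket_power_sums mult.assoc)
    have "Const (1 / c) * poly_bracket (power_sum k) (power_sum_bar l) + ?r = bipower_sum k l"
      unfolding bracket_eq mult.assoc[of "Const (1 / c)", symmetric] c by simp
    moreover have "Const (1 / c) * poly_bracket (power_sum k) (power_sum_bar l) + ?r \<in> U"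
      by (intro add_mem mult_mem Const_mem bracket power_sums)
    ultimately show ?thesis by simp
  qed
  then show ?thesis using assms(5) by (rule symmetric_mem_of_bipower_sums)
qed

text \<open>Generation reduces to obtaining all power sums from \<open>G\<close> by algebra operations and congruences
  modulo the ideal; the bracket then supplies the mixed power sums.  The set \<open>U\<close> of interest
  consists of the polynomials whose classes lie in the Poisson span.\<close>

lemma poisson_generates_adjoint_quotientI:
  fixes G :: "'n::finite zpoly set"
  assumes sym: "\<And>p. p \<in> G \<Longrightarrow> symmetric p"
    and power_sums: "\<And>U k. zpoly_subalgebra U \<Longrightarrow> G \<subseteq> U \<Longrightarrow>
      (\<And>p q. p \<in> U \<Longrightarrow> p - q \<in> torus_ideal \<Longrightarrow> q \<in> U) \<Longrightarrow> power_sum k \<in> U \<and> power_sum_bar k \<in> U"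
  shows "poisson_generates (adjoint_quotient :: (complex, 'n zpoly set) poisson_algebra) (cls ` G)"
  unfolding poisson_generates_def
proof (intro conjI equalityI subsetI)
  let ?P = "adjoint_quotient :: (complex, 'n zpoly set) poisson_algebra"
  show "a \<in> carrier ?P" if "a \<in> cls ` G" for a
    using that sym by (auto simp: carrier_adjoint_quotient)
  show "a \<in> carrier ?P" if "a \<in> poisson_span ?P (cls ` G)" for a
    using that unfolding carrier_adjoint_quotient
  proof (induction rule: poisson_span.induct)
    case (incl a)
    then show ?case using sym by auto
  next
    case one
    show ?case using symmetric_one by (auto simp: adjoint_quotient_cls)
  next
    case (smult a c)
    then show ?case by (auto simp: adjoint_quotient_cls intro!: imageI symmetric_mult symmetric_Const)
  qed (auto simp: adjoint_quotient_cls intro!: imageI symmetric_add symmetric_mult symmetric_poly_bracket)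
  define U where "U = {p. cls p \<in> poisson_span ?P (cls ` G)}"
  have U: "zpoly_subalgebra U"
  proof
    fix c and p q :: "'n zpoly"
    have "cls 1 \<in> poisson_span ?P (cls ` G)"
      using poisson_span.one[of ?P] by (simp add: adjoint_quotient_cls)
    from poisson_span.smult[OF this, of c] show "Const c \<in> U"
      by (simp add: U_def adjoint_quotient_cls)
    show "p + q \<in> U" "p * q \<in> U" if "p \<in> U" "q \<in> U"
      using that poisson_span.add[of "cls p" ?P _ "cls q"] poisson_span.mult[of "cls p" ?P _ "cls q"]
      by (simp_all add: U_def adjoint_quotient_cls)
  qed
  have bracket: "poly_bracket p q \<in> U" if "p \<in> U" "q \<in> U" for p q
    using that poisson_span.bracket[of "cls p" ?P _ "cls q"] by (simp add: U_def adjoint_quotient_cls)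
  have "G \<subseteq> U" by (auto simp: U_def intro: poisson_span.incl)
  moreover have "q \<in> U" if "p \<in> U" "p - q \<in> torus_ideal" for p q
    using that by (simp add: U_def flip: cls_eq_iff)
  ultimately have "power_sum k \<in> U \<and> power_sum_bar k \<in> U" for k
    by (intro power_sums[OF U]) auto
  then have "p \<in> U" if "symmetric p" for p
    using symmetric_mem_of_power_sums[OF U bracket _ _ that] by blast
  then show "a \<in> poisson_span ?P (cls ` G)" if "a \<in> carrier ?P" for a
    using that by (auto simp: carrier_adjoint_quotient U_def)
qed

theorem corollary3p8p4:
  assumes "CARD('n::finite) \<ge> 2"
  shows "poisson_generates (adjoint_quotient :: (complex, 'n zpoly set) poisson_algebra)
      (cls ` (power_sum ` {1..CARD('n)} \<union> power_sum_bar ` {1..CARD('n)})) \<and>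
    poisson_generates (adjoint_quotient :: (complex, 'n zpoly set) poisson_algebra)
      (cls ` (elem_sym ` {1..CARD('n) - 1} \<union> elem_sym_bar ` {1..CARD('n) - 1}))"
proof
  show "poisson_generates (adjoint_quotient :: (complex, 'n zpoly set) poisson_algebra)
      (cls ` (power_sum ` {1..CARD('n)} \<union> power_sum_bar ` {1..CARD('n)}))"
  proof (rule poisson_generates_adjoint_quotientI)
    fix U :: "'n zpoly set" and k
    assume U: "zpoly_subalgebra U" and G: "power_sum ` {1..CARD('n)} \<union> power_sum_bar ` {1..CARD('n)} \<subseteq> U"
    interpret zpoly_subalgebra U by (rule U)
    show "power_sum k \<in> U \<and> power_sum_bar k \<in> U"
      unfolding power_sum_def power_sum_bar_def
    proof (rule conjI; rule power_sum_mem_of_elementary; rule elementary_mem_of_power_sums)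
      fix i assume "1 \<le> i" "i \<le> CARD('n)"
      then have "power_sum i \<in> U" "power_sum_bar i \<in> U" using G by auto
      then show "(\<Sum>j\<in>UNIV. Var (Inl j :: 'n + 'n) ^ i) \<in> U" "(\<Sum>j\<in>UNIV. Var (Inr j :: 'n + 'n) ^ i) \<in> U"
        by (simp_all add: power_sum_def power_sum_bar_def)
    qed
  qed (auto simp: symmetric_power_sum symmetric_power_sum_bar)
  show "poisson_generates (adjoint_quotient :: (complex, 'n zpoly set) poisson_algebra)
      (cls ` (elem_sym ` {1..CARD('n) - 1} \<union> elem_sym_bar ` {1..CARD('n) - 1}))"
  proof (rule poisson_generates_adjoint_quotientI)
    fix U :: "'n zpoly set" and k
    assume U: "zpoly_subalgebra U" and G: "elem_sym ` {1..CARD('n) - 1} \<union> elem_sym_bar ` {1..CARD('n) - 1} \<subseteq> U"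
      and congruent: "\<And>p q. p \<in> U \<Longrightarrow> p - q \<in> torus_ideal \<Longrightarrow> q \<in> U"
    interpret zpoly_subalgebra U by (rule U)
    have "elem_sym i \<in> U \<and> elem_sym_bar i \<in> U" for i
    proof -
      consider "i = 0" | "i \<in> {1..CARD('n) - 1}" | "i = CARD('n)" | "i > CARD('n)" by force
      then show ?thesis
      proof cases
        case 1
        have "{S :: 'n set. card S = 0} = {{}}" by auto
        then show ?thesis using 1 one_mem by (simp add: elem_sym_def elem_sym_bar_def)
      next
        case 2
        then show ?thesis using G by auto
      next
        case 3
        have "1 - elem_sym CARD('n) \<in> (torus_ideal :: 'n zpoly set)" "1 - elem_sym_bar CARD('n) \<in> (torus_ideal :: 'n zpoly set)"
          using torus_ideal_diff[OF torus_ideal_zero elem_sym_minus_1_in_torus_ideal(1)]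
            torus_ideal_diff[OF torus_ideal_zero elem_sym_minus_1_in_torus_ideal(2)] by simp_all
        then show ?thesis using 3 congruent[OF one_mem] by blast
      next
        case 4
        have "card S \<le> CARD('n)" for S :: "'n set" by (rule card_mono) auto
        then have "{S :: 'n set. card S = i} = {}" using 4 by (auto simp: not_less[symmetric])
        then show ?thesis by (simp only: elem_sym_def elem_sym_bar_def sum.empty zero_mem)
      qed
    qed
    then have e: "(\<Sum>S | card S = i. \<Prod>j\<in>S. Var (Inl j :: 'n + 'n)) \<in> U"
      "(\<Sum>S | card S = i. \<Prod>j\<in>S. Var (Inr j :: 'n + 'n)) \<in> U" for i
      by (simp_all add: elem_sym_def elem_sym_bar_def)
    show "power_sum k \<in> U \<and> power_sum_bar k \<in> U"
      unfolding power_sum_def power_sum_bar_def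
      using power_sum_mem_of_elementary[OF e(1)] power_sum_mem_of_elementary[OF e(2)] by (rule conjI)
  qed (auto simp: symmetric_elem_sym symmetric_elem_sym_bar)
qed

end
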